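(* Let $f:\mathbb{R}^n\to\mathbb{R}^n$ be continuously differentiable, let $q:\mathbb{R}^n\to\mathbb{R}\cup\{+\infty\}$ be proper, convex and lower semicontinuous, and let $H(x)=f(x)+\partial q(x)$. Let $\bar x\in H^{-1}(0)$, assume that $\partial q$ is SCD semismooth$^*$ at $(\bar x,-f(\bar x))$ and suppose that $H$ is SCD regular around $(\bar x,0)$. Then for every pair $\underline{\gamma},\bar\gamma$ with $0<\underline{\gamma}\le\bar\gamma$ there exists a neighborhood $U$ of $\bar x$ such that for every starting point $x^{(0)}\in U$ the semismooth$^*$ Newton method for $0\in H(x)$ (described in the context), with $\gamma^{(k)}\in[\underline{\gamma},\bar\gamma]$ chosen in every iteration step, either stops after finitely many iterations at a solution of $0\in H(x)$ or produces a sequence $x^{(k)}$ converging superlinearly to $\bar x$.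
   Context: $\partial$ is the subdifferential of convex analysis, $\nabla f(x)$ the Jacobian of $f$. For $F:\mathbb{R}^n\rightrightarrows\mathbb{R}^n$, $\mathrm{gph}\,F=\{(x,y)\mid y\in F(x)\}$. The tangent (Bouligand) cone to $A$ at $\bar x\in A$ is $T_A(\bar x)=\{u\mid \exists t_k\downarrow 0,\ u_k\to u:\ \bar x+t_ku_k\in A\ \forall k\}$. $\mathcal{Z}_n$ is the metric space of all $n$-dimensional linear subspaces of $\mathbb{R}^{2n}$ with metric $d_{\mathcal Z}(L_1,L_2)=\|P_{L_1}-P_{L_2}\|$ ($P_L$ the orthogonal projection matrix onto $L$, spectral norm). Elements of $\mathbb{R}^{2n}$ are written $(u,v)$ with $u,v\in\mathbb{R}^n$. For $L\in\mathcal{Z}_n$ put $L^*=\{(-v^*,u^* )\mid(u^*,v^* )\in L^\perp\}\in\mathcal{Z}_n$. For $n\times n$ matrices $A,B$, $\mathrm{rge}(A,B)=\{(Au,Bu)\mid u\in\mathbb{R}^n\}$. $\mathcal{O}_F$ is the set of points $(x,y)\in\mathrm{gph}\,F$ with $T_{\mathrm{gph}\,F}(x,y)\in\mathcal{Z}_n$. For $(x,y)\in\mathrm{gph}\,F$, $$\mathcal{S}^*F(x,y)=\{L\in\mathcal{Z}_n\mid\exists(x_k,y_k)\in\mathcal{O}_F,\ (x_k,y_k)\to(x,y):\ \lim_{k\to\infty} d_{\mathcal Z}(L,T_{\mathrm{gph}\,F}(x_k,y_k)^* )=0\}.$$ $F$ has the SCD property around $(x,y)\in\mathrm{gph}\,F$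 if there is a neighborhood $W$ of $(x,y)$ with $\mathcal{S}^*F(x',y')\ne\emptyset$ for all $(x',y')\in\mathrm{gph}\,F\cap W$. (For proper lsc convex $q$, $\mathcal{S}^*\partial q(x,x^* )\neq\emptyset$ at every $(x,x^* )\in\mathrm{gph}\,\partial q$.) $F$ is SCD regular around $(x,y)\in\mathrm{gph}\,F$ if it has the SCD property around $(x,y)$ and for every $L\in\mathcal{S}^*F(x,y)$ one has $(y^*,0)\in L\Rightarrow y^*=0$. $F$ is SCD semismooth$^*$ at $(\bar x,\bar y)\in\mathrm{gph}\,F$ if $F$ has the SCD property around $(\bar x,\bar y)$ and for every $\epsilon>0$ there is $\delta>0$ such that $$|\langle x^*,x-\bar x\rangle-\langle y^*,y-\bar y\rangle|\le\epsilon\|(x,y)-(\bar x,\bar y)\|\,\|(x^*,y^* )\|$$ for all $(x,y)\in\mathrm{gph}\,F$ with $\|(x,y)-(\bar x,\bar y)\|\le\delta$ and all $(y^*,x^* )$ belonging to any $L\in\mathcal{S}^*F(x,y)$. For $\gamma>0$ and $x\in\mathbb{R}^n$, $u_\gamma(x)$ denotes the unique minimizer over $u\in\mathbb{R}^n$ of $\frac{\gamma}{2}\|u\|^2+\langle f(x),u\rangle+q(x+u)$; equivalently it is the unique $u$ with $0\in\gamma u+f(x)+\partial q(x+u)$. Semismooth$^*$ Newton method for $0\in H(x)$: 1. Choose a starting point $x^{(0)}$ and set $k:=0$. 2. If $0\in H(x^{(k)})$, stop. 3. Select $\gamma^{(k)}>0$, compute $u^{(k)}:=u_{\gamma^{(k)}}(x^{(k)})$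 and set $\hat d^{(k)}:=x^{(k)}+u^{(k)}$, $\hat d^{*(k)}:=-\gamma^{(k)}u^{(k)}-f(x^{(k)})$ (so $(\hat d^{(k)},\hat d^{*(k)})\in\mathrm{gph}\,\partial q$). 4. Select any $n\times n$ matrices $X^{*(k)},Y^{*(k)}$ with $\mathrm{rge}(Y^{*(k)},X^{*(k)})\in\mathcal{S}^*\partial q(\hat d^{(k)},\hat d^{*(k)})$, compute the Newton direction $\Delta x^{(k)}$ as the solution of $$\big((Y^{*(k)})^T\nabla f(x^{(k)})+(X^{*(k)})^T\big)\Delta x^{(k)}=\big(\gamma^{(k)}(Y^{*(k)})^T+(X^{*(k)})^T\big)u^{(k)},$$ and set $x^{(k+1)}=x^{(k)}+\Delta x^{(k)}$. 5. Set $k:=k+1$ and go to Step 2. Superlinear convergence of $x^{(k)}$ to $\bar x$ means $x^{(k)}\to\bar x$ and $\|x^{(k+1)}-\bar x\|=o(\|x^{(k)}-\bar x\|)$. *)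

theory Defs
  imports "HOL-Analysis.Analysis" "HOL-Library.Landau_Symbols"
begin

text \<open>
  \<open>\<real>\<^sup>n\<close> is a Euclidean space \<open>'a\<close> with \<open>n = DIM('a)\<close> (concretely \<open>real ^ 'n\<close> as soon as
  matrices occur), and \<open>\<real>\<^sup>2\<^sup>n\<close> is \<open>'a \<times> 'a\<close>, whose library norm and inner product are the
  Euclidean ones.
\<close>

section \<open>Convex analysis\<close>

definition proper_fun :: "('a \<Rightarrow> ereal) \<Rightarrow> bool" where
  "proper_fun q \<longleftrightarrow> (\<forall>x. q x \<noteq> -\<infinity>) \<and> (\<exists>x. q x \<noteq> \<infinity>)"

text \<open>At \<open>t = 0\<close> and \<open>t = 1\<close> the convention \<open>0 * \<infinity> = 0\<close> of \<open>ereal\<close> makes the inequality trivial.\<close>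

definition convex_fun :: "('a::real_vector \<Rightarrow> ereal) \<Rightarrow> bool" where
  "convex_fun q \<longleftrightarrow>
     (\<forall>x y. \<forall>t\<in>{0..1}. q ((1 - t) *\<^sub>R x + t *\<^sub>R y) \<le> ereal (1 - t) * q x + ereal t * q y)"

definition lsc_fun :: "('a::topological_space \<Rightarrow> ereal) \<Rightarrow> bool" where
  "lsc_fun q \<longleftrightarrow> (\<forall>x. q x \<le> Liminf (at x) q)"

definition subdifferential :: "('a::real_inner \<Rightarrow> ereal) \<Rightarrow> 'a \<Rightarrow> 'a set" where
  "subdifferential q x = {v. \<bar>q x\<bar> \<noteq> \<infinity> \<and> (\<forall>y. q x + ereal (v \<bullet> (y - x)) \<le> q y)}"


section \<open>Set-valued maps and the SCD notions\<close>

definition gph :: "('a \<Rightarrow> 'b set) \<Rightarrow> ('a \<times> 'b) set" where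
  "gph F = {(x, y). y \<in> F x}"

definition tangent_cone :: "'a::real_normed_vector set \<Rightarrow> 'a \<Rightarrow> 'a set" where
  "tangent_cone A x =
     {u. \<exists>(t :: nat \<Rightarrow> real) (w :: nat \<Rightarrow> 'a).
           (\<forall>k. 0 < t k) \<and> t \<longlonglongrightarrow> 0 \<and> w \<longlonglongrightarrow> u \<and> (\<forall>k. x + t k *\<^sub>R w k \<in> A)}"

definition Zn :: "('a::euclidean_space \<times> 'a) set set" where
  "Zn = {L. subspace L \<and> dim L = DIM('a)}"

definition orth_proj :: "'a::euclidean_space set \<Rightarrow> 'a \<Rightarrow> 'a" where
  "orth_proj L z = (THE p. p \<in> L \<and> z - p \<in> L\<^sup>\<bottom>)"

text \<open>The spectral norm of a matrix is the operator norm of the linear map it represents.\<close>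

definition dist_Z :: "'a::euclidean_space set \<Rightarrow> 'a set \<Rightarrow> real" where
  "dist_Z L1 L2 = onorm (\<lambda>z. orth_proj L1 z - orth_proj L2 z)"

definition dual_subspace :: "('a::euclidean_space \<times> 'a) set \<Rightarrow> ('a \<times> 'a) set" where
  "dual_subspace L = {(- v, u) | u v. (u, v) \<in> L\<^sup>\<bottom>}"

definition smooth_pts :: "('a::euclidean_space \<Rightarrow> 'a set) \<Rightarrow> ('a \<times> 'a) set" where
  "smooth_pts F = {z \<in> gph F. tangent_cone (gph F) z \<in> Zn}"

definition SCD_coderiv :: "('a::euclidean_space \<Rightarrow> 'a set) \<Rightarrow> 'a \<Rightarrow> 'a \<Rightarrow> ('a \<times> 'a) set set" where
  "SCD_coderiv F x y =
     {L \<in> Zn. \<exists>z :: nat \<Rightarrow> 'a \<times> 'a. (\<forall>k. z k \<in> smooth_pts F) \<and> z \<longlonglongrightarrow> (x, y) \<and>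
        (\<lambda>k. dist_Z L (dual_subspace (tangent_cone (gph F) (z k)))) \<longlonglongrightarrow> 0}"

definition SCD_property :: "('a::euclidean_space \<Rightarrow> 'a set) \<Rightarrow> 'a \<Rightarrow> 'a \<Rightarrow> bool" where
  "SCD_property F x y \<longleftrightarrow> (x, y) \<in> gph F \<and>
     (\<exists>W. open W \<and> (x, y) \<in> W \<and> (\<forall>(x', y') \<in> gph F \<inter> W. SCD_coderiv F x' y' \<noteq> {}))"

definition SCD_regular :: "('a::euclidean_space \<Rightarrow> 'a set) \<Rightarrow> 'a \<Rightarrow> 'a \<Rightarrow> bool" where
  "SCD_regular F x y \<longleftrightarrow> SCD_property F x y \<and>
     (\<forall>L \<in> SCD_coderiv F x y. \<forall>ys. (ys, 0) \<in> L \<longrightarrow> ys = 0)"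

text \<open>The elements of the subspaces in \<open>SCD_coderiv F x y\<close> are pairs \<open>(ys, xs)\<close>, in this order.\<close>

definition SCD_semismooth_star :: "('a::euclidean_space \<Rightarrow> 'a set) \<Rightarrow> 'a \<Rightarrow> 'a \<Rightarrow> bool" where
  "SCD_semismooth_star F xbar ybar \<longleftrightarrow> SCD_property F xbar ybar \<and>
     (\<forall>\<epsilon>>0. \<exists>\<delta>>0. \<forall>(x, y) \<in> gph F. norm ((x, y) - (xbar, ybar)) \<le> \<delta> \<longrightarrow>
        (\<forall>L \<in> SCD_coderiv F x y. \<forall>(ys, xs) \<in> L.
           \<bar>xs \<bullet> (x - xbar) - ys \<bullet> (y - ybar)\<bar>
             \<le> \<epsilon> * norm ((x, y) - (xbar, ybar)) * norm (xs, ys)))"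


section \<open>The semismooth* Newton method\<close>

definition gen_map :: "(real^'n \<Rightarrow> real^'n) \<Rightarrow> (real^'n \<Rightarrow> ereal) \<Rightarrow> real^'n \<Rightarrow> (real^'n) set" where
  "gen_map f q x = {f x + v | v. v \<in> subdifferential q x}"

definition u_gamma ::
  "(real^'n \<Rightarrow> real^'n) \<Rightarrow> (real^'n \<Rightarrow> ereal) \<Rightarrow> real \<Rightarrow> real^'n \<Rightarrow> real^'n" where
  "u_gamma f q \<gamma> x =
     (THE u. is_arg_min (\<lambda>u. ereal (\<gamma> / 2 * (norm u)\<^sup>2 + f x \<bullet> u) + q (x + u)) (\<lambda>_. True) u)"

definition d_hat ::
  "(real^'n \<Rightarrow> real^'n) \<Rightarrow> (real^'n \<Rightarrow> ereal) \<Rightarrow> real \<Rightarrow> real^'n \<Rightarrow> real^'n" where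
  "d_hat f q \<gamma> x = x + u_gamma f q \<gamma> x"

definition d_hat_star ::
  "(real^'n \<Rightarrow> real^'n) \<Rightarrow> (real^'n \<Rightarrow> ereal) \<Rightarrow> real \<Rightarrow> real^'n \<Rightarrow> real^'n" where
  "d_hat_star f q \<gamma> x = - \<gamma> *\<^sub>R u_gamma f q \<gamma> x - f x"

definition rge :: "real^'n^'n \<Rightarrow> real^'n^'n \<Rightarrow> ((real^'n) \<times> (real^'n)) set" where
  "rge A B = range (\<lambda>u. (A *v u, B *v u))"

definition admissible_matrices ::
  "(real^'n \<Rightarrow> real^'n) \<Rightarrow> (real^'n \<Rightarrow> ereal) \<Rightarrow> real \<Rightarrow> real^'n \<Rightarrow> real^'n^'n \<Rightarrow> real^'n^'n \<Rightarrow> bool"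
where
  "admissible_matrices f q \<gamma> x X Y \<longleftrightarrow>
     rge Y X \<in> SCD_coderiv (subdifferential q) (d_hat f q \<gamma> x) (d_hat_star f q \<gamma> x)"

definition newton_equation ::
  "(real^'n \<Rightarrow> real^'n) \<Rightarrow> (real^'n \<Rightarrow> ereal) \<Rightarrow> real \<Rightarrow> real^'n \<Rightarrow> real^'n^'n \<Rightarrow> real^'n^'n
     \<Rightarrow> real^'n \<Rightarrow> bool"
where
  "newton_equation f q \<gamma> x X Y \<Delta>x \<longleftrightarrow>
     (transpose Y ** jacobian f (at x) + transpose X) *v \<Delta>x
       = (\<gamma> *\<^sub>R transpose Y + transpose X) *v u_gamma f q \<gamma> x"

definition newton_step ::
  "(real^'n \<Rightarrow> real^'n) \<Rightarrow> (real^'n \<Rightarrow> ereal) \<Rightarrow> real \<Rightarrow> real^'n \<Rightarrow> real^'n^'n \<Rightarrow> real^'n^'n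
     \<Rightarrow> real^'n \<Rightarrow> bool"
where
  "newton_step f q \<gamma> x X Y x' \<longleftrightarrow>
     0 < \<gamma> \<and> admissible_matrices f q \<gamma> x X Y \<and>
     (\<exists>\<Delta>x. newton_equation f q \<gamma> x X Y \<Delta>x \<and> x' = x + \<Delta>x)"

text \<open>
  \<open>newton_run_upto f q \<gamma>l \<gamma>u \<gamma> X Y x N\<close>: the iterates \<open>x 0, \<dots>, x N\<close> have been produced by the method
  with \<open>\<gamma>\<^sub>k \<in> [\<gamma>l, \<gamma>u]\<close>, up to its first stop. Once \<open>0 \<in> H (x k)\<close> the method has stopped and
  the later entries of the sequences are irrelevant.
\<close>

definition newton_run_upto ::
  "(real^'n \<Rightarrow> real^'n) \<Rightarrow> (real^'n \<Rightarrow> ereal) \<Rightarrow> real \<Rightarrow> real \<Rightarrow> (nat \<Rightarrow> real)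
     \<Rightarrow> (nat \<Rightarrow> real^'n^'n) \<Rightarrow> (nat \<Rightarrow> real^'n^'n) \<Rightarrow> (nat \<Rightarrow> real^'n) \<Rightarrow> nat \<Rightarrow> bool"
where
  "newton_run_upto f q \<gamma>l \<gamma>u \<gamma> X Y x N \<longleftrightarrow>
     (\<forall>k<N. (\<forall>j\<le>k. 0 \<notin> gen_map f q (x j)) \<longrightarrow>
        \<gamma> k \<in> {\<gamma>l..\<gamma>u} \<and> newton_step f q (\<gamma> k) (x k) (X k) (Y k) (x (Suc k)))"

text \<open>The current iterate \<open>x\<close> does not break the method down, whatever the remaining choices are.\<close>

definition newton_step_possible ::
  "(real^'n \<Rightarrow> real^'n) \<Rightarrow> (real^'n \<Rightarrow> ereal) \<Rightarrow> real \<Rightarrow> real \<Rightarrow> real^'n \<Rightarrow> bool"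
where
  "newton_step_possible f q \<gamma>l \<gamma>u x \<longleftrightarrow>
     (\<forall>\<gamma>\<in>{\<gamma>l..\<gamma>u}. (\<exists>X Y. admissible_matrices f q \<gamma> x X Y) \<and>
        (\<forall>X Y. admissible_matrices f q \<gamma> x X Y \<longrightarrow> (\<exists>!\<Delta>x. newton_equation f q \<gamma> x X Y \<Delta>x)))"

definition converges_superlinearly :: "(nat \<Rightarrow> 'a::real_normed_vector) \<Rightarrow> 'a \<Rightarrow> bool" where
  "converges_superlinearly x xbar \<longleftrightarrow> x \<longlonglongrightarrow> xbar \<and>
     (\<lambda>k. norm (x (Suc k) - xbar)) \<in> o(\<lambda>k. norm (x k - xbar))"

end

theory Submission
  imports Defs
begin

text \<open>
  Write \<open>J x\<close> for the Jacobian of \<open>f\<close>. Everything rests on two estimates near \<open>xbar\<close>, for an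
  iterate \<open>x\<close> with auxiliary point \<open>(d, d*)\<close> in the graph of \<open>\<partial>q\<close> and error \<open>e = x - xbar\<close>.

  First, \<open>(d, d*)\<close> is within \<open>C * norm e\<close> of \<open>(xbar, - f xbar)\<close>, with \<open>C\<close> uniform in
  \<open>\<gamma> \<in> [\<gamma>l, \<gamma>u]\<close> (\<open>prox_step_estimate\<close>). Both points lie in the graph of \<open>\<partial>q\<close>, so this is
  monotonicity of \<open>\<partial>q\<close> combined with \<open>norm (f x - f xbar) \<le> K * norm e\<close>. That \<open>(d, d*)\<close> exists
  at all is the existence and uniqueness of the minimiser of a strongly convex function; the affine
  minorant of \<open>q\<close> given by the subgradient \<open>- f xbar\<close> supplies the coercivity.

  Secondly, there is \<open>\<kappa>\<close> with \<open>norm (y, z) \<le> \<kappa> * norm ((J x)\<^sup>T y + z)\<close> for all pairs \<open>(y, z)\<close> in all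
  subspaces \<open>L \<in> S*\<partial>q(d, d*)\<close> at nearby points (\<open>SCD_regular_uniform_bound\<close>). Otherwise there
  would be unit vectors \<open>(y, z)\<close> in such subspaces, at points tending to \<open>(xbar, - f xbar)\<close>, with
  \<open>(J x)\<^sup>T y + z\<close> tending to \<open>0\<close>. The shear \<open>(y, z) \<mapsto> (y, z + (J x)\<^sup>T y)\<close> carries the dual tangent
  spaces of the graph of \<open>\<partial>q\<close> to those of the graph of \<open>H = f + \<partial>q\<close>, and the Grassmannian is compact,
  so in the limit one obtains some \<open>L \<in> S*H(xbar, 0)\<close> and a vector \<open>(y, 0) \<in> L\<close>. Regularity of \<open>H\<close>
  forces \<open>y = 0\<close>, hence also \<open>z = 0\<close>, which contradicts the normalisation.

  The Newton matrix \<open>M = Y\<^sup>T J x + X\<^sup>T\<close> satisfies \<open>M\<^sup>T p = (J x)\<^sup>T (Y p) + X p\<close>, so the second estimate,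
  applied to \<open>(Y p, X p)\<close>, makes \<open>M\<close> invertible with control over its inverse. The new error \<open>e'\<close>
  satisfies
    \<open>p \<bullet> M e' = (X p) \<bullet> (d - xbar) - (Y p) \<bullet> (d* + f xbar) + (Y p) \<bullet> (f xbar - f x + J x e)\<close>
  (\<open>newton_error_identity\<close>). The first two terms are exactly the expression that semismoothness*
  makes small relative to \<open>norm (Y p, X p)\<close>, and the last one is a linearisation error. Choosing \<open>p\<close> with
  \<open>M\<^sup>T p = e'\<close> gives \<open>norm e' \<le> \<theta> * norm e\<close> for each prescribed \<open>\<theta> > 0\<close>, if \<open>x\<close> is close enough to
  \<open>xbar\<close> (\<open>newton_contraction\<close>). With \<open>\<theta> = 1/2\<close> the iterates stay in a ball and converge, and
  arbitrarily small \<open>\<theta>\<close> then gives the superlinear rate.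
\<close>

section \<open>Orthogonal projections and compactness of the Grassmannian\<close>

lemma orth_proj_unique:
  fixes L :: "'a::euclidean_space set"
  assumes "subspace L" and "p \<in> L" and "z - p \<in> L\<^sup>\<bottom>"
  shows "orth_proj L z = p"
  unfolding orth_proj_def
proof (rule the_equality)
  show "p \<in> L \<and> z - p \<in> L\<^sup>\<bottom>" using assms by simp
  fix p' assume p': "p' \<in> L \<and> z - p' \<in> L\<^sup>\<bottom>"
  have "p' - p \<in> L" using assms p' by (simp add: subspace_diff)
  moreover have "p' - p \<in> L\<^sup>\<bottom>"
    using subspace_diff[OF subspace_orthogonal_comp assms(3), of "z - p'"] p' by simp
  ultimately have "(p' - p) \<bullet> (p' - p) = 0"
    by (auto simp: orthogonal_comp_def orthogonal_def)
  then show "p' = p" by simp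
qed

lemma
  fixes L :: "'a::euclidean_space set"
  assumes "subspace L"
  shows orth_proj_in: "orth_proj L z \<in> L"
    and orth_proj_residual: "z - orth_proj L z \<in> L\<^sup>\<bottom>"
proof -
  obtain p r where "p \<in> L" "\<And>w. w \<in> L \<Longrightarrow> orthogonal r w" "z = p + r"
    using orthogonal_subspace_decomp_exists[of L z] assms span_eq_iff by metis
  then have *: "p \<in> L" "z - p \<in> L\<^sup>\<bottom>"
    by (auto simp: orthogonal_comp_def orthogonal_commute)
  then have "orth_proj L z = p" using orth_proj_unique[OF assms] by blast
  with * show "orth_proj L z \<in> L" "z - orth_proj L z \<in> L\<^sup>\<bottom>" by simp_all
qed

lemma orth_proj_fixes:
  fixes L :: "'a::euclidean_space set"
  assumes "subspace L" and "z \<in> L"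
  shows "orth_proj L z = z"
  using assms by (intro orth_proj_unique) (simp_all add: subspace_orthogonal_comp subspace_0)

lemma norm_orth_proj_le:
  fixes L :: "'a::euclidean_space set"
  assumes "subspace L"
  shows "norm (orth_proj L z) \<le> norm z"
proof -
  let ?p = "orth_proj L z"
  have "?p \<bullet> (z - ?p) = 0"
    using orth_proj_in[OF assms] orth_proj_residual[OF assms]
    by (auto simp: orthogonal_comp_def orthogonal_def)
  then have "(norm ?p)\<^sup>2 = ?p \<bullet> z"
    by (simp add: inner_diff_right power2_norm_eq_inner)
  also have "\<dots> \<le> norm ?p * norm z" by (rule norm_cauchy_schwarz)
  finally show ?thesis
    by (cases "?p = 0") (auto simp: power2_eq_square)
qed

lemma bounded_linear_orth_proj:
  fixes L :: "'a::euclidean_space set"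
  assumes "subspace L"
  shows "bounded_linear (orth_proj L)"
proof (rule linear_conv_bounded_linear[THEN iffD1], rule linearI)
  fix y z :: 'a and c :: real
  note P = orth_proj_in[OF assms] orth_proj_residual[OF assms]
  have "y + z - (orth_proj L y + orth_proj L z) \<in> L\<^sup>\<bottom>"
    using subspace_add[OF subspace_orthogonal_comp P(2)[of y] P(2)[of z]] by (simp add: add_diff_add)
  then show "orth_proj L (y + z) = orth_proj L y + orth_proj L z"
    using P assms by (intro orth_proj_unique subspace_add)
  have "c *\<^sub>R z - c *\<^sub>R orth_proj L z = c *\<^sub>R (z - orth_proj L z)"
    by (simp add: scaleR_diff_right)
  then have "c *\<^sub>R z - c *\<^sub>R orth_proj L z \<in> L\<^sup>\<bottom>"
    using subspace_scale[OF subspace_orthogonal_comp P(2)[of z]] by simp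
  then show "orth_proj L (c *\<^sub>R z) = c *\<^sub>R orth_proj L z"
    using P assms by (intro orth_proj_unique subspace_scale)
qed

lemma norm_orth_proj_diff_le:
  fixes L M :: "'a::euclidean_space set"
  assumes "subspace L" and "subspace M"
  shows "norm (orth_proj L z - orth_proj M z) \<le> dist_Z L M * norm z"
  unfolding dist_Z_def
  by (rule onorm) (intro bounded_linear_sub bounded_linear_orth_proj assms)

lemma dist_Z_commute: "dist_Z L M = dist_Z M L"
  unfolding dist_Z_def onorm_def by (simp add: norm_minus_commute)

text \<open>
  If the projections differ by less than \<open>1\<close> in norm, the projection onto \<open>M\<close> cannot annihilate a
  nonzero vector of \<open>L\<close>, so it embeds \<open>L\<close> into \<open>M\<close>.
\<close>

lemma dim_le_if_dist_Z_less_1: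
  fixes L M :: "'a::euclidean_space set"
  assumes "subspace L" and "subspace M" and "dist_Z L M < 1"
  shows "dim L \<le> dim M"
proof -
  interpret P: bounded_linear "orth_proj M" by (rule bounded_linear_orth_proj[OF assms(2)])
  have "z = 0" if "z \<in> L" "orth_proj M z = 0" for z
  proof (rule ccontr)
    assume "z \<noteq> 0"
    have "norm z \<le> dist_Z L M * norm z"
      using norm_orth_proj_diff_le[OF assms(1,2), of z] orth_proj_fixes[OF assms(1) that(1)] that(2)
      by simp
    also have "\<dots> < 1 * norm z"
      using \<open>z \<noteq> 0\<close> assms(3) by (intro mult_strict_right_mono) auto
    finally show False by simp
  qed
  then have "inj_on (orth_proj M) (span L)"
    using P.linear_axioms assms(1) by (simp add: linear_inj_on_iff_eq_0 span_eq_iff[THEN iffD2])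
  then have "dim (orth_proj M ` L) = dim L"
    using P.linear_axioms by (rule dim_image_eq[rotated])
  moreover have "orth_proj M ` L \<subseteq> M" using orth_proj_in[OF assms(2)] by auto
  ultimately show ?thesis using dim_subset by metis
qed

text \<open>
  The projections lie in the compact unit ball of the space of operators. A limit of orthogonal
  projections is again the orthogonal projection onto its range, and by
  \<open>dim_le_if_dist_Z_less_1\<close> the dimension cannot jump in the limit.
\<close>

lemma Grassmannian_convergent_subsequence:
  fixes L :: "nat \<Rightarrow> 'a::euclidean_space set"
  assumes sub: "\<And>k. subspace (L k)" and dim: "\<And>k. dim (L k) = d"
  obtains S r where "strict_mono r" and "subspace S" and "dim S = d"
    and "(\<lambda>k. dist_Z S (L (r k))) \<longlonglongrightarrow> 0"
proof -
  define P where "P k = Blinfun (orth_proj (L k))" for k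
  have P: "blinfun_apply (P k) = orth_proj (L k)" for k
    unfolding P_def by (intro bounded_linear_Blinfun_apply bounded_linear_orth_proj sub)
  have "norm (P k) \<le> 1" for k
    using norm_orth_proj_le[OF sub] by (intro norm_blinfun_bound) (simp_all add: P)
  then have "bounded (range P)" by (auto simp: bounded_iff)
  then obtain Q r where r: "strict_mono r" and lim: "(P \<circ> r) \<longlonglongrightarrow> Q"
    using bounded_imp_convergent_subsequence by blast
  have limz: "(\<lambda>k. orth_proj (L (r k)) z) \<longlonglongrightarrow> Q z" for z
    using blinfun.tendsto[OF lim tendsto_const[of z]] by (simp add: o_def P)
  define S where "S = range Q"
  have S: "subspace S"
    unfolding S_def using linear_subspace_image[OF bounded_linear.linear[OF blinfun.bounded_linear_right] subspace_UNIV] .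
  \<comment> \<open>This characterises orthogonal projections and is preserved by pointwise limits.\<close>
  have orth: "Q y \<bullet> (z - Q z) = 0" for y z
  proof (rule LIMSEQ_unique)
    show "(\<lambda>k. orth_proj (L (r k)) y \<bullet> (z - orth_proj (L (r k)) z)) \<longlonglongrightarrow> Q y \<bullet> (z - Q z)"
      by (intro tendsto_intros limz)
    have "orth_proj (L (r k)) y \<bullet> (z - orth_proj (L (r k)) z) = 0" for k
      using orth_proj_in[OF sub[of "r k"], of y] orth_proj_residual[OF sub[of "r k"], of z]
      by (auto simp: orthogonal_comp_def orthogonal_def)
    then show "(\<lambda>k. orth_proj (L (r k)) y \<bullet> (z - orth_proj (L (r k)) z)) \<longlonglongrightarrow> 0" by simp
  qed
  have QS: "orth_proj S z = Q z" for z
    by (rule orth_proj_unique[OF S]) (auto simp: S_def orthogonal_comp_def orthogonal_def orth)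
  have distS: "dist_Z S (L (r k)) = norm (Q - P (r k))" for k
    by (simp add: dist_Z_def QS norm_blinfun.rep_eq blinfun.diff_left P [symmetric] minus_blinfun.rep_eq)
  have conv: "(\<lambda>k. dist_Z S (L (r k))) \<longlonglongrightarrow> 0"
  proof -
    have "(\<lambda>k. norm (Q - P (r k))) \<longlonglongrightarrow> norm (Q - Q)"
      using lim by (intro tendsto_intros) (simp add: o_def)
    then show ?thesis by (simp add: distS)
  qed
  then have "\<forall>\<^sub>F k in sequentially. dist_Z S (L (r k)) < 1"
    by (rule order_tendstoD) simp
  then obtain k where k: "dist_Z S (L (r k)) < 1" by (auto simp: eventually_sequentially)
  then have "dim S = d"
    using dim_le_if_dist_Z_less_1[OF S sub k] dim_le_if_dist_Z_less_1[OF sub S, of "r k"] dim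
    by (simp add: dist_Z_commute)
  with r S conv that show ?thesis by blast
qed

lemma limit_in_limit_subspace:
  fixes S :: "'a::euclidean_space set"
  assumes "subspace S" and "\<And>k. subspace (L k)" and "(\<lambda>k. dist_Z S (L k)) \<longlonglongrightarrow> 0"
    and "\<And>k. z k \<in> L k" and "z \<longlonglongrightarrow> w"
  shows "w \<in> S"
proof -
  interpret P: bounded_linear "orth_proj S" by (rule bounded_linear_orth_proj[OF assms(1)])
  have "(\<lambda>k. norm (orth_proj S (z k) - z k)) \<longlonglongrightarrow> 0"
  proof (rule Lim_null_comparison)
    show "\<forall>\<^sub>F k in sequentially. norm (norm (orth_proj S (z k) - z k)) \<le> dist_Z S (L k) * norm (z k)"
    proof (rule always_eventually, rule allI)
      fix k
      show "norm (norm (orth_proj S (z k) - z k)) \<le> dist_Z S (L k) * norm (z k)"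
        using norm_orth_proj_diff_le[OF assms(1) assms(2)[of k], of "z k"]
          orth_proj_fixes[OF assms(2,4)] by simp
    qed
    show "(\<lambda>k. dist_Z S (L k) * norm (z k)) \<longlonglongrightarrow> 0"
      using tendsto_mult[OF assms(3) tendsto_norm[OF assms(5)]] by simp
  qed
  moreover have "(\<lambda>k. norm (orth_proj S (z k) - z k)) \<longlonglongrightarrow> norm (orth_proj S w - w)"
    by (intro tendsto_intros P.tendsto assms)
  ultimately have "orth_proj S w = w" using LIMSEQ_unique by fastforce
  then show ?thesis using orth_proj_in[OF assms(1)] by metis
qed

section \<open>Elements of \<open>Zn\<close>: dual subspaces and ranges of matrix pairs\<close>

lemma dual_subspace_iff: "(a, b) \<in> dual_subspace L \<longleftrightarrow> (b, - a) \<in> L\<^sup>\<bottom>"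
  unfolding dual_subspace_def by force

lemma dual_subspace_in_Zn:
  assumes "L \<in> Zn"
  shows "dual_subspace (L :: ('a::euclidean_space \<times> 'a) set) \<in> Zn"
proof -
  let ?J = "\<lambda>z :: 'a \<times> 'a. (- snd z, fst z)"
  have eq: "dual_subspace L = ?J ` (L\<^sup>\<bottom>)" by (force simp: dual_subspace_def)
  have J: "linear ?J" by (rule linearI) auto
  have "inj ?J" by (auto simp: inj_on_def prod_eq_iff)
  then have "dim (?J ` (L\<^sup>\<bottom>)) = dim (L\<^sup>\<bottom>)"
    by (intro dim_image_eq[OF J]) (auto intro: inj_on_subset)
  moreover have "dim (L\<^sup>\<bottom>) + dim L = dim (UNIV :: ('a \<times> 'a) set)"
    using dim_subspace_orthogonal_to_vectors[of L UNIV] assms by (simp add: Zn_def orthogonal_comp_def)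
  ultimately show ?thesis
    using assms linear_subspace_image[OF J subspace_orthogonal_comp] by (simp add: Zn_def eq dim_UNIV)
qed

text \<open>
  The range of \<open>u \<mapsto> (Y u, X u)\<close> has the dimension of the domain, so the map is injective.
\<close>

lemma rge_in_Zn_inj:
  fixes X Y :: "real^'n^'n"
  assumes "rge Y X \<in> Zn" and "Y *v p = 0" and "X *v p = 0"
  shows "p = 0"
proof -
  let ?h = "\<lambda>u. (Y *v u, X *v u)"
  have h: "linear ?h"
    by (rule linearI) (auto simp: matrix_vector_right_distrib matrix_vector_mult_scaleR)
  obtain g :: "(real^'n) \<times> (real^'n) \<Rightarrow> real^'n" where g: "linear g" "g ` rge Y X = UNIV"
    using subspace_isomorphism[of "rge Y X" "UNIV :: (real^'n) set"] assms(1)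
    by (auto simp: Zn_def dim_UNIV)
  have "linear (g \<circ> ?h)" using h g(1) by (rule linear_compose)
  moreover have "surj (g \<circ> ?h)" using g(2) by (simp add: rge_def image_comp)
  ultimately have "inj (g \<circ> ?h)" by (rule linear_surjective_imp_injective) simp
  moreover have "(g \<circ> ?h) p = (g \<circ> ?h) 0" using assms by simp
  ultimately show ?thesis by (rule injD)
qed

lemma Zn_eq_rge:
  fixes L :: "((real^'n) \<times> (real^'n)) set"
  assumes "L \<in> Zn"
  obtains X Y where "rge Y X = L"
proof -
  obtain h :: "real^'n \<Rightarrow> (real^'n) \<times> (real^'n)" where h: "linear h" "h ` UNIV = L"
    using subspace_isomorphism[of "UNIV :: (real^'n) set" L] assms by (auto simp: Zn_def dim_UNIV)
  have "linear (\<lambda>u. fst (h u))" "linear (\<lambda>u. snd (h u))"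
    using linear_compose[OF h(1) linear_fst] linear_compose[OF h(1) linear_snd] by (simp_all add: o_def)
  then have "rge (matrix (\<lambda>u. fst (h u))) (matrix (\<lambda>u. snd (h u))) = L"
    using h(2) by (simp add: rge_def matrix_works)
  then show ?thesis using that by blast
qed

section \<open>The proximal step\<close>

lemma subdifferential_monotone:
  assumes "v \<in> subdifferential q x" and "w \<in> subdifferential q y"
  shows "0 \<le> (v - w) \<bullet> (x - y)"
proof -
  obtain a b where ab: "q x = ereal a" "q y = ereal b"
    using assms by (auto simp: subdifferential_def)
  have "q x + ereal (v \<bullet> (y - x)) \<le> q y" "q y + ereal (w \<bullet> (x - y)) \<le> q x"
    using assms by (auto simp: subdifferential_def)
  then have "a + v \<bullet> (y - x) \<le> b" "b + w \<bullet> (x - y) \<le> a" by (simp_all add: ab)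
  then show ?thesis by (simp add: algebra_simps inner_diff_left inner_diff_right)
qed

lemma lsc_fun_eventually_greater:
  assumes "lsc_fun q" and "c < q x"
  shows "\<forall>\<^sub>F y in nhds x. c < q y"
proof -
  have "q x \<le> Liminf (at x) q" using assms(1) by (simp add: lsc_fun_def)
  then have "\<forall>\<^sub>F y in at x. c < q y" using assms(2) by (simp add: le_Liminf_iff)
  then show ?thesis using assms(2) by (auto simp: eventually_at_filter elim: eventually_mono)
qed

definition prox_objective :: "real \<Rightarrow> 'a::real_inner \<Rightarrow> ('a \<Rightarrow> ereal) \<Rightarrow> 'a \<Rightarrow> 'a \<Rightarrow> ereal" where
  "prox_objective \<gamma> c q x u = ereal (\<gamma> / 2 * (norm u)\<^sup>2 + c \<bullet> u) + q (x + u)"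

text \<open>
  Comparing \<open>u\<close> with \<open>u + t z\<close>, \<open>z = y - (x + u)\<close>, and using convexity of \<open>q\<close> along this segment
  gives the subgradient inequality at \<open>y\<close> up to an error of order \<open>t\<close>, which disappears as \<open>t\<close>
  tends to \<open>0\<close>.
\<close>

lemma prox_minimizer_subgradient:
  assumes "convex_fun q" and "proper_fun q" and "0 < \<gamma>"
    and min: "\<And>w. prox_objective \<gamma> c q x u \<le> prox_objective \<gamma> c q x w"
  shows "- \<gamma> *\<^sub>R u - c \<in> subdifferential q (x + u)"
proof -
  have ninf: "q y \<noteq> -\<infinity>" for y using assms(2) by (simp add: proper_fun_def)
  obtain y0 where "q y0 \<noteq> \<infinity>" using assms(2) by (auto simp: proper_fun_def)
  then have "prox_objective \<gamma> c q x (y0 - x) \<noteq> \<infinity>" by (simp add: prox_objective_def)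
  then have "prox_objective \<gamma> c q x u \<noteq> \<infinity>" using min[of "y0 - x"] by auto
  then obtain a where a: "q (x + u) = ereal a"
    using ninf[of "x + u"] by (cases "q (x + u)") (auto simp: prox_objective_def)
  have "q (x + u) + ereal ((- \<gamma> *\<^sub>R u - c) \<bullet> (y - (x + u))) \<le> q y" for y
  proof (cases "q y")
    case (real b)
    define z where "z = y - (x + u)"
    define A where "A = a - b - (\<gamma> *\<^sub>R u + c) \<bullet> z"
    define B where "B = \<gamma> / 2 * (norm z)\<^sup>2"
    have "0 \<le> B" using assms(3) by (simp add: B_def)
    have key: "A \<le> t * B" if t: "0 < t" "t \<le> 1" for t
    proof -
      have pt: "(1 - t) *\<^sub>R (x + u) + t *\<^sub>R y = x + (u + t *\<^sub>R z)"
        by (simp add: z_def algebra_simps)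
      have "q (x + (u + t *\<^sub>R z)) \<le> ereal (1 - t) * q (x + u) + ereal t * q y"
        using assms(1) t unfolding convex_fun_def pt[symmetric] by simp
      then have "q (x + (u + t *\<^sub>R z)) \<le> ereal ((1 - t) * a + t * b)"
        by (simp add: a real)
      then have "prox_objective \<gamma> c q x (u + t *\<^sub>R z)
          \<le> ereal (\<gamma> / 2 * (norm (u + t *\<^sub>R z))\<^sup>2 + c \<bullet> (u + t *\<^sub>R z)) + ereal ((1 - t) * a + t * b)"
        unfolding prox_objective_def by (intro add_left_mono)
      then have "prox_objective \<gamma> c q x u
          \<le> ereal (\<gamma> / 2 * (norm (u + t *\<^sub>R z))\<^sup>2 + c \<bullet> (u + t *\<^sub>R z)) + ereal ((1 - t) * a + t * b)"
        using min order_trans by blast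
      then have "\<gamma> / 2 * (norm u)\<^sup>2 + c \<bullet> u + a
          \<le> \<gamma> / 2 * (norm (u + t *\<^sub>R z))\<^sup>2 + c \<bullet> (u + t *\<^sub>R z) + (1 - t) * a + t * b"
        by (simp add: prox_objective_def a)
      moreover have "(norm (u + t *\<^sub>R z))\<^sup>2 = (norm u)\<^sup>2 + 2 * t * (u \<bullet> z) + t * (t * (norm z)\<^sup>2)"
        by (simp add: power2_norm_eq_inner inner_add_left inner_add_right inner_commute algebra_simps)
      ultimately have "0 \<le> t * (t * B - A)"
        by (simp add: A_def B_def inner_add_left inner_add_right field_simps)
      then show ?thesis using t by (simp add: zero_le_mult_iff)
    qed
    have "A \<le> 0"
    proof (rule ccontr)
      assume "\<not> A \<le> 0"
      define t where "t = min 1 (A / (B + 1))"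
      have t: "0 < t" "t \<le> 1" using \<open>\<not> A \<le> 0\<close> \<open>0 \<le> B\<close> by (auto simp: t_def)
      have "t * (B + 1) \<le> A"
        using \<open>0 \<le> B\<close> by (simp add: t_def min_le_iff_disj pos_le_divide_eq[symmetric])
      then show False using key[OF t] t by (simp add: algebra_simps)
    qed
    then show ?thesis
      by (simp add: A_def z_def[symmetric] a real inner_diff_left inner_add_left)
  next
    case PInf
    then show ?thesis by simp
  next
    case MInf
    then show ?thesis using ninf by simp
  qed
  then show ?thesis by (simp add: subdifferential_def a)
qed

lemma prox_objective_eventually_greater:
  assumes "lsc_fun q" and "proper_fun q" and "ereal c < prox_objective \<gamma> p q x u"
  shows "\<forall>\<^sub>F w in nhds u. ereal c < prox_objective \<gamma> p q x w"
proof -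
  define g where "g w = \<gamma> / 2 * (norm w)\<^sup>2 + p \<bullet> w" for w
  have obj: "prox_objective \<gamma> p q x w = ereal (g w) + q (x + w)" for w
    by (simp add: prox_objective_def g_def)
  have "ereal (c - g u) < q (x + u)"
    using assms(3) unfolding obj by (cases "q (x + u)") auto
  then obtain r where r: "c - g u < r" "ereal r < q (x + u)"
    using ereal_dense2 by (metis less_ereal.simps(1))
  have g: "g \<midarrow>u\<rightarrow> g u" unfolding g_def by (intro tendsto_intros)
  have "\<forall>\<^sub>F w in nhds u. c - r < g w"
  proof -
    have "isCont g u" using g by (simp add: isCont_def)
    then show ?thesis
      using order_tendstoD(1)[of g "g u" "nhds u" "c - r"] r(1) by (simp add: isCont_def tendsto_at_iff_tendsto_nhds)
  qed
  moreover have "\<forall>\<^sub>F w in nhds u. ereal r < q (x + w)"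
  proof -
    have "filterlim (\<lambda>w. x + w) (nhds (x + u)) (nhds u)"
      by (rule tendsto_add[OF tendsto_const filterlim_ident])
    then show ?thesis
      using lsc_fun_eventually_greater[OF assms(1) r(2)] by (auto simp: filterlim_iff)
  qed
  ultimately show ?thesis
  proof eventually_elim
    case (elim w)
    then show ?case unfolding obj by (cases "q (x + w)") auto
  qed
qed

lemma lsc_attains_min:
  fixes g :: "'a::heine_borel \<Rightarrow> ereal"
  assumes "compact K" and "u0 \<in> K"
    and lsc: "\<And>u c. ereal c < g u \<Longrightarrow> \<forall>\<^sub>F w in nhds u. ereal c < g w"
  obtains u where "u \<in> K" and "\<And>w. w \<in> K \<Longrightarrow> g u \<le> g w"
proof -
  define m where "m = Inf (g ` K)"
  have "\<exists>s. (\<forall>n. s n \<in> g ` K) \<and> s \<longlonglongrightarrow> m"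
    unfolding m_def using Inf_as_limit[of "g ` K"] assms(2) by blast
  then obtain s where s: "\<And>n::nat. s n \<in> g ` K" "s \<longlonglongrightarrow> m" by blast
  have "\<forall>n. \<exists>w. w \<in> K \<and> g w = s n"
  proof
    fix n
    show "\<exists>w. w \<in> K \<and> g w = s n" using s(1)[of n] by (auto simp: image_iff)
  qed
  from choice[OF this] obtain w where "\<forall>n. w n \<in> K \<and> g (w n) = s n" ..
  then have w: "\<And>n. w n \<in> K" "\<And>n. g (w n) = s n" by simp_all
  obtain u r where u: "u \<in> K" "strict_mono r" "(w \<circ> r) \<longlonglongrightarrow> u"
  proof (rule seq_compactE)
    show "seq_compact K" using assms(1) by (rule compact_imp_seq_compact)
  qed (use w(1) in auto)
  have lim: "(\<lambda>n. g (w (r n))) \<longlonglongrightarrow> m"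
    using LIMSEQ_subseq_LIMSEQ[OF s(2) u(2)] w(2) by (simp add: o_def)
  have "g u \<le> m"
  proof (rule ccontr)
    assume "\<not> g u \<le> m"
    then obtain c where c: "m < ereal c" "ereal c < g u" using ereal_dense2[of m "g u"] by (auto simp: not_le)
    have "\<forall>\<^sub>F n in sequentially. ereal c < g ((w \<circ> r) n)"
      using lsc[OF c(2)] u(3) unfolding filterlim_iff by blast
    moreover have "\<forall>\<^sub>F n in sequentially. g (w (r n)) < ereal c"
      using order_tendstoD(2)[OF lim c(1)] .
    ultimately have "\<forall>\<^sub>F n in sequentially. False" by eventually_elim simp
    then show False by simp
  qed
  then have "g u \<le> g v" if "v \<in> K" for v
    using that unfolding m_def by (meson INF_lower order_trans)
  with u(1) show ?thesis using that by blast
qed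

text \<open>
  The affine minorant of \<open>q\<close> given by the subgradient \<open>v0\<close>, exact at \<open>x0\<close>, shows that outside a
  ball the objective is at least its value at \<open>u0 = x0 - x\<close>; inside the ball lower semicontinuity yields
  a minimiser.
\<close>

lemma prox_minimizer_exists:
  fixes q :: "'a::euclidean_space \<Rightarrow> ereal"
  assumes "proper_fun q" and "lsc_fun q" and "v0 \<in> subdifferential q x0" and "0 < \<gamma>"
  obtains u where "\<And>w. prox_objective \<gamma> c q x u \<le> prox_objective \<gamma> c q x w"
proof -
  define u0 where "u0 = x0 - x"
  define \<Delta> where "\<Delta> = norm (c + v0)"
  \<comment> \<open>For \<open>norm w > R\<close> the growth \<open>\<gamma> / 2 * (norm w ^ 2 - norm u0 ^ 2)\<close> of the quadratic term is at
    least the largest possible decrease \<open>\<Delta> * norm (u0 - w)\<close> of the affine part.\<close>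
  define R where "R = norm u0 + 2 * \<Delta> / \<gamma>"
  obtain a where a: "q x0 = ereal a" using assms(3) by (auto simp: subdifferential_def)
  have R: "norm u0 \<le> R" using assms(4) by (simp add: R_def \<Delta>_def)
  obtain u where u: "u \<in> cball 0 R"
    "\<And>w. w \<in> cball 0 R \<Longrightarrow> prox_objective \<gamma> c q x u \<le> prox_objective \<gamma> c q x w"
  proof (rule lsc_attains_min[of "cball 0 R" u0 "prox_objective \<gamma> c q x"])
    show "u0 \<in> cball 0 R" using R by simp
  qed (use prox_objective_eventually_greater[OF assms(2,1)] in auto)
  have "prox_objective \<gamma> c q x u0 \<le> prox_objective \<gamma> c q x w" if w: "R < norm w" for w
  proof -
    have "\<Delta> * (norm w + norm u0) \<le> \<gamma> / 2 * ((norm w)\<^sup>2 - (norm u0)\<^sup>2)"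
    proof -
      have "2 * \<Delta> \<le> \<gamma> * (norm w - norm u0)"
        using w assms(4) by (simp add: R_def field_simps)
      then have "2 * \<Delta> * (norm w + norm u0) \<le> \<gamma> * (norm w - norm u0) * (norm w + norm u0)"
        by (rule mult_right_mono) simp
      then show ?thesis by (simp add: power2_eq_square algebra_simps)
    qed
    moreover have "(c + v0) \<bullet> (u0 - w) \<le> \<Delta> * (norm w + norm u0)"
    proof -
      have "(c + v0) \<bullet> (u0 - w) \<le> \<Delta> * norm (u0 - w)"
        unfolding \<Delta>_def by (rule norm_cauchy_schwarz)
      also have "\<dots> \<le> \<Delta> * (norm w + norm u0)"
        using norm_triangle_ineq4[of u0 w] by (intro mult_left_mono) (auto simp: \<Delta>_def)
      finally show ?thesis .
    qed
    ultimately have "\<gamma> / 2 * (norm u0)\<^sup>2 + c \<bullet> u0 + a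
        \<le> \<gamma> / 2 * (norm w)\<^sup>2 + c \<bullet> w + (a + v0 \<bullet> (x + w - x0))"
      by (simp add: u0_def algebra_simps inner_diff_right inner_add_left inner_add_right)
    then have "prox_objective \<gamma> c q x u0
        \<le> ereal (\<gamma> / 2 * (norm w)\<^sup>2 + c \<bullet> w) + (q x0 + ereal (v0 \<bullet> (x + w - x0)))"
      by (simp add: prox_objective_def u0_def a)
    also have "\<dots> \<le> prox_objective \<gamma> c q x w"
      using assms(3) unfolding prox_objective_def by (intro add_left_mono) (simp add: subdifferential_def)
    finally show ?thesis .
  qed
  moreover have "prox_objective \<gamma> c q x u \<le> prox_objective \<gamma> c q x u0" using u(2) R by simp
  ultimately have "prox_objective \<gamma> c q x u \<le> prox_objective \<gamma> c q x w" for w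
    using u(2)[of w] by (cases "R < norm w") (auto intro: order_trans)
  then show ?thesis using that by blast
qed

text \<open>
  Two minimisers coincide because \<open>\<partial>q\<close> is monotone and \<open>\<gamma> > 0\<close>. Hence the definite description in
  \<open>u_gamma\<close> denotes the minimiser, whose optimality condition is the claim.
\<close>

lemma u_gamma_subgradient:
  fixes f :: "real^'n \<Rightarrow> real^'n"
  assumes "proper_fun q" and "convex_fun q" and "lsc_fun q" and "subdifferential q x0 \<noteq> {}" and "0 < \<gamma>"
  shows "d_hat_star f q \<gamma> x \<in> subdifferential q (d_hat f q \<gamma> x)"
proof -
  let ?\<phi> = "prox_objective \<gamma> (f x) q x"
  have sub: "- \<gamma> *\<^sub>R u - f x \<in> subdifferential q (x + u)" if "\<And>w. ?\<phi> u \<le> ?\<phi> w" for u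
    using prox_minimizer_subgradient[OF assms(2,1,5) that] .
  obtain u where u: "\<And>w. ?\<phi> u \<le> ?\<phi> w"
    using prox_minimizer_exists[OF assms(1,3) _ assms(5)] assms(4) by blast
  have "u_gamma f q \<gamma> x = u"
    unfolding u_gamma_def prox_objective_def[symmetric]
  proof (rule the_equality)
    show "is_arg_min ?\<phi> (\<lambda>_. True) u" using u by (simp add: is_arg_min_def not_less)
    fix u' assume "is_arg_min ?\<phi> (\<lambda>_. True) u'"
    then have "\<And>w. ?\<phi> u' \<le> ?\<phi> w" by (simp add: is_arg_min_def not_less)
    from subdifferential_monotone[OF sub[OF u] sub[OF this]]
    have "0 \<le> - \<gamma> * ((u - u') \<bullet> (u - u'))"
      by (simp add: algebra_simps inner_diff_left inner_diff_right)
    then have "(u - u') \<bullet> (u - u') \<le> 0" using assms(5) by (simp add: mult_le_0_iff)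
    then have "(u - u') \<bullet> (u - u') = 0" by (intro antisym) simp_all
    then show "u' = u" by simp
  qed
  then show ?thesis using sub[OF u] by (simp add: d_hat_def d_hat_star_def)
qed

section \<open>Sums with a smooth map and the uniform bound from SCD regularity\<close>

text \<open>
  Adding \<open>g\<close> moves the point \<open>(x + t p, v + t s)\<close> of the graph of \<open>F\<close> to
  \<open>(x + t p, v + g x + t (s + d))\<close>, where \<open>d\<close> is the difference quotient of \<open>g\<close> in direction \<open>p\<close>, and
  \<open>d\<close> tends to \<open>D a\<close> when \<open>p\<close> tends to \<open>a\<close>.
\<close>

lemma tangent_cone_gph_add_subset:
  fixes F G :: "'a::real_normed_vector \<Rightarrow> 'b::real_normed_vector set"
  assumes "\<And>x y. y \<in> F x \<Longrightarrow> y + g x \<in> G x"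
    and deriv: "(g has_derivative D) (at x)"
    and "(a, b) \<in> tangent_cone (gph F) (x, v)"
  shows "(a, b + D a) \<in> tangent_cone (gph G) (x, v + g x)"
proof -
  obtain t w where t: "\<And>k::nat. 0 < t k" "t \<longlonglongrightarrow> 0" and w: "w \<longlonglongrightarrow> (a, b)"
    and mem: "\<And>k. (x, v) + t k *\<^sub>R w k \<in> gph F"
    using assms(3) unfolding tangent_cone_def by blast
  interpret D: bounded_linear D using deriv by (rule has_derivative_bounded_linear)
  define p where "p k = fst (w k)" for k
  define d where "d k = (g (x + t k *\<^sub>R p k) - g x) /\<^sub>R t k" for k
  have p: "p \<longlonglongrightarrow> a" using tendsto_fst[OF w] by (simp add: p_def[abs_def])
  \<comment> \<open>The value \<open>r 0 = 0 / 0 = 0\<close> is also the limit of \<open>r\<close> at \<open>0\<close>, so \<open>r\<close> may be evaluated along \<open>t k *\<^sub>R p k\<close>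
    even where \<open>p k = 0\<close>.\<close>
  define r where "r h = norm (g (x + h) - g x - D h) / norm h" for h
  have "r \<midarrow>0\<rightarrow> r 0"
    using deriv by (simp add: has_derivative_at r_def[abs_def])
  then have "isCont r 0" by (simp add: isCont_def)
  moreover have "(\<lambda>k. t k *\<^sub>R p k) \<longlonglongrightarrow> 0" using tendsto_scaleR[OF t(2) p] by simp
  ultimately have "(\<lambda>k. r (t k *\<^sub>R p k)) \<longlonglongrightarrow> r 0" by (rule isCont_tendsto_compose)
  then have r: "(\<lambda>k. r (t k *\<^sub>R p k) * norm (p k)) \<longlonglongrightarrow> 0 * norm a"
    using p by (intro tendsto_intros) (simp_all add: r_def)
  have "norm (d k - D (p k)) = r (t k *\<^sub>R p k) * norm (p k)" for k
  proof (cases "p k = 0")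
    case True
    then show ?thesis by (simp add: d_def D.zero)
  next
    case False
    have "d k - D (p k) = (g (x + t k *\<^sub>R p k) - g x - D (t k *\<^sub>R p k)) /\<^sub>R t k"
      using t(1)[of k] by (simp add: d_def D.scaleR scaleR_diff_right)
    then have "norm (d k - D (p k)) = norm (g (x + t k *\<^sub>R p k) - g x - D (t k *\<^sub>R p k)) / t k"
      using t(1)[of k] by (simp add: divide_inverse mult.commute)
    then show ?thesis
      using False t(1)[of k] by (simp add: r_def)
  qed
  then have "(\<lambda>k. d k - D (p k)) \<longlonglongrightarrow> 0" using r tendsto_norm_zero_iff[of "\<lambda>k. d k - D (p k)"] by simp
  from tendsto_add[OF this D.tendsto[OF p]] have d: "d \<longlonglongrightarrow> D a" by simp
  define w' where "w' k = (p k, snd (w k) + d k)" for k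
  have "w' \<longlonglongrightarrow> (a, b + D a)"
    unfolding w'_def using tendsto_snd[OF w] by (intro tendsto_intros p d) simp
  moreover have "(x, v + g x) + t k *\<^sub>R w' k \<in> gph G" for k
  proof -
    have "v + t k *\<^sub>R snd (w k) \<in> F (x + t k *\<^sub>R p k)"
      using mem[of k] by (cases "w k") (simp add: gph_def p_def)
    from assms(1)[OF this] show ?thesis
      using t(1)[of k] by (simp add: gph_def w'_def d_def algebra_simps)
  qed
  ultimately show ?thesis
    unfolding tangent_cone_def using t by blast
qed

lemma tangent_cone_gph_add:
  fixes F G :: "'a::real_normed_vector \<Rightarrow> 'b::real_normed_vector set"
  assumes FG: "\<And>x y. y \<in> F x \<longleftrightarrow> y + g x \<in> G x" and deriv: "(g has_derivative D) (at x)"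
  shows "tangent_cone (gph G) (x, v + g x) = (\<lambda>(a, b). (a, b + D a)) ` tangent_cone (gph F) (x, v)"
    (is "?T = ?\<Phi> ` ?S")
proof
  show "?\<Phi> ` ?S \<subseteq> ?T"
    using tangent_cone_gph_add_subset[of F g G, OF _ deriv] FG by auto
  have sub: "(a, b - D a) \<in> ?S" if ab: "(a, b) \<in> ?T" for a b
  proof -
    have "(a, b + - D a) \<in> tangent_cone (gph F) (x, v + g x + - g x)"
    proof (rule tangent_cone_gph_add_subset[of G "\<lambda>x. - g x" F])
      show "y + - g x \<in> F x" if "y \<in> G x" for x y
        using that FG[of "y - g x" x] by simp
    qed (use has_derivative_minus[OF deriv] ab in simp_all)
    then show ?thesis by simp
  qed
  show "?T \<subseteq> ?\<Phi> ` ?S"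
  proof clarify
    fix a b assume "(a, b) \<in> ?T"
    from sub[OF this] have "(a, b - D a) \<in> ?S" by simp
    then show "(a, b) \<in> ?\<Phi> ` ?S" by force
  qed
qed

text \<open>
  The tangent spaces correspond under the shear \<open>(a, b) \<mapsto> (a, b + A a)\<close>; passing to orthogonal
  complements, the dual spaces correspond under \<open>(a, b) \<mapsto> (a, b + A\<^sup>T a)\<close>.
\<close>

lemma smooth_pts_gph_add:
  fixes F G :: "real^'n \<Rightarrow> (real^'n) set"
  assumes FG: "\<And>x y. y \<in> F x \<longleftrightarrow> y + g x \<in> G x"
    and deriv: "(g has_derivative ((*v) A)) (at x)"
    and smooth: "(x, v) \<in> smooth_pts F"
  shows "(x, v + g x) \<in> smooth_pts G"
    and "(a, b) \<in> dual_subspace (tangent_cone (gph F) (x, v)) \<Longrightarrow>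
      (a, b + a v* A) \<in> dual_subspace (tangent_cone (gph G) (x, v + g x))"
proof -
  let ?\<Phi> = "\<lambda>(a, b). (a, b + A *v a)"
  let ?S = "tangent_cone (gph F) (x, v)"
  have S: "subspace ?S" "dim ?S = DIM(real^'n)" "(x, v) \<in> gph F"
    using smooth by (auto simp: smooth_pts_def Zn_def)
  have T: "tangent_cone (gph G) (x, v + g x) = ?\<Phi> ` ?S"
    using tangent_cone_gph_add[OF FG deriv] .
  have \<Phi>: "linear ?\<Phi>"
    by (rule linearI) (auto simp: matrix_vector_right_distrib matrix_vector_mult_scaleR algebra_simps)
  have "inj ?\<Phi>" by (auto simp: inj_on_def)
  then have "dim (?\<Phi> ` ?S) = dim ?S"
    by (intro dim_image_eq[OF \<Phi>]) (auto intro: inj_on_subset)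
  then have "?\<Phi> ` ?S \<in> Zn"
    using S linear_subspace_image[OF \<Phi>] by (simp add: Zn_def)
  moreover have "(x, v + g x) \<in> gph G" using S(3) FG by (simp add: gph_def)
  ultimately show "(x, v + g x) \<in> smooth_pts G" by (simp add: smooth_pts_def T)
  assume "(a, b) \<in> dual_subspace ?S"
  then show "(a, b + a v* A) \<in> dual_subspace (tangent_cone (gph G) (x, v + g x))"
    unfolding T dual_subspace_iff orthogonal_comp_def orthogonal_def
    by (auto simp: inner_add_left inner_add_right dot_lmul_matrix inner_commute[of _ "a v* A"]
        inner_commute[of "A *v _"])
qed

lemma tendsto_vector_matrix_mult:
  fixes v :: "'b \<Rightarrow> real^'n" and A :: "'b \<Rightarrow> real^'m^'n"
  assumes "(v \<longlongrightarrow> w) F" and "(A \<longlongrightarrow> B) F"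
  shows "((\<lambda>x. v x v* A x) \<longlongrightarrow> w v* B) F"
  unfolding vector_matrix_mult_def by (intro tendsto_intros assms)

lemma tendsto_0_if_le_inverse_Suc:
  fixes f :: "nat \<Rightarrow> 'a::real_normed_vector"
  assumes "\<And>k. norm (f k) \<le> inverse (real (Suc k))"
  shows "f \<longlonglongrightarrow> 0"
  by (rule Lim_null_comparison[OF always_eventually LIMSEQ_inverse_real_of_nat]) (use assms in auto)

text \<open>
  The subspaces in \<open>S*F\<close> are only limits of dual tangent spaces, so the argument first replaces the
  violating unit vector \<open>e k\<close> of a subspace of \<open>S*F\<close> by its projection \<open>p k\<close> onto a dual tangent
  space \<open>\<epsilon> k\<close>-close to that subspace. A tangent space transforms exactly under
  addition of \<open>g\<close>, so these spaces can be carried over to \<open>G\<close>, where compactness yields the limit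
  subspace.
\<close>

lemma SCD_regular_uniform_bound:
  fixes F G :: "real^'n \<Rightarrow> (real^'n) set"
  assumes FG: "\<And>x y. y \<in> F x \<longleftrightarrow> y + g x \<in> G x"
    and deriv: "\<And>x. (g has_derivative ((*v) (A x))) (at x)"
    and cont: "isCont A xbar"
    and reg: "\<And>L ys. L \<in> SCD_coderiv G xbar (ybar + g xbar) \<Longrightarrow> (ys, 0) \<in> L \<Longrightarrow> ys = 0"
  obtains \<kappa> \<rho> where "0 < \<kappa>" and "0 < \<rho>"
    and "\<And>u x y L ys xs. \<lbrakk>norm (u - xbar) < \<rho>; norm ((x, y) - (xbar, ybar)) < \<rho>;
        L \<in> SCD_coderiv F x y; (ys, xs) \<in> L\<rbrakk> \<Longrightarrow> norm (ys, xs) \<le> \<kappa> * norm (ys v* A u + xs)"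
proof (rule ccontr)
  assume contra: "\<not> thesis"
  note bound = that
  define \<epsilon> where "\<epsilon> k = inverse (real (Suc k))" for k
  have \<epsilon>: "0 < \<epsilon> k" "real (Suc k) * \<epsilon> k = 1" for k by (simp_all add: \<epsilon>_def)
  have \<epsilon>0: "f \<longlonglongrightarrow> 0" if "\<And>k. norm (f k) \<le> \<epsilon> k" for f :: "nat \<Rightarrow> 'c::real_normed_vector"
    using that unfolding \<epsilon>_def by (rule tendsto_0_if_le_inverse_Suc)
  have "\<exists>u s p. norm (u - xbar) \<le> \<epsilon> k \<and> s \<in> smooth_pts F \<and> norm (s - (xbar, ybar)) \<le> 2 * \<epsilon> k \<and>
      p \<in> dual_subspace (tangent_cone (gph F) s) \<and> (\<exists>e. norm e = 1 \<and> norm (p - e) \<le> \<epsilon> k \<and>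
        norm (fst e v* A u + snd e) \<le> \<epsilon> k)" for k
  proof -
    obtain u x y L ys xs where *: "norm (u - xbar) < \<epsilon> k" "norm ((x, y) - (xbar, ybar)) < \<epsilon> k"
      "L \<in> SCD_coderiv F x y" "(ys, xs) \<in> L"
      "\<not> norm (ys, xs) \<le> real (Suc k) * norm (ys v* A u + xs)"
      using contra bound[of "real (Suc k)" "\<epsilon> k"] \<epsilon>(1)[of k] by fastforce
    have L: "subspace L" using *(3) by (auto simp: SCD_coderiv_def Zn_def)
    define N where "N = norm (ys, xs)"
    have "0 \<le> real (Suc k) * norm (ys v* A u + xs)" by simp
    then have N: "0 < N" using *(5) unfolding N_def by linarith
    define e where "e = (ys, xs) /\<^sub>R N"
    have "e \<in> L" unfolding e_def using L *(4) by (rule subspace_scale)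
    moreover have "norm e = 1" using N unfolding e_def norm_scaleR by (simp add: N_def)
    ultimately have e: "e \<in> L" "norm e = 1" by simp_all
    have "fst e v* A u + snd e = (ys v* A u + xs) /\<^sub>R N"
      by (simp add: e_def scaleR_vector_matrix_assoc[symmetric] scaleR_add_right vector_scaleR_matrix_ac)
    then have "norm (fst e v* A u + snd e) = norm (ys v* A u + xs) / N"
      using N by (simp add: divide_inverse mult.commute)
    moreover have "real (Suc k) * norm (ys v* A u + xs) \<le> N"
      using *(5) by (simp add: N_def)
    ultimately have "real (Suc k) * norm (fst e v* A u + snd e) \<le> 1"
      using N by (simp add: pos_divide_le_eq del: of_nat_Suc)
    then have small: "norm (fst e v* A u + snd e) \<le> \<epsilon> k"
      by (simp add: \<epsilon>_def field_simps)
    obtain z where z: "\<And>j. z j \<in> smooth_pts F" "z \<longlonglongrightarrow> (x, y)"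
      and d: "(\<lambda>j. dist_Z L (dual_subspace (tangent_cone (gph F) (z j)))) \<longlonglongrightarrow> 0"
      using *(3) unfolding SCD_coderiv_def by blast
    have "\<forall>\<^sub>F j in sequentially. dist (z j) (x, y) < \<epsilon> k"
      using z(2) \<epsilon>(1) by (rule tendstoD)
    moreover have "\<forall>\<^sub>F j in sequentially. dist_Z L (dual_subspace (tangent_cone (gph F) (z j))) < \<epsilon> k"
      using order_tendstoD(2)[OF d \<epsilon>(1)] .
    ultimately have "\<forall>\<^sub>F j in sequentially. dist (z j) (x, y) < \<epsilon> k \<and>
        dist_Z L (dual_subspace (tangent_cone (gph F) (z j))) < \<epsilon> k"
      by (rule eventually_conj)
    then obtain j where j: "dist (z j) (x, y) < \<epsilon> k"
        "dist_Z L (dual_subspace (tangent_cone (gph F) (z j))) < \<epsilon> k"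
      by (auto simp: eventually_sequentially)
    let ?M = "dual_subspace (tangent_cone (gph F) (z j))"
    have M: "subspace ?M"
      using z(1)[of j] dual_subspace_in_Zn[of "tangent_cone (gph F) (z j)"]
      by (simp add: smooth_pts_def Zn_def)
    have "norm (orth_proj ?M e - e) \<le> \<epsilon> k"
      using norm_orth_proj_diff_le[OF L M, of e] orth_proj_fixes[OF L e(1)] j(2) e(2)
      by (simp add: norm_minus_commute)
    moreover have "norm (z j - (xbar, ybar)) \<le> 2 * \<epsilon> k"
    proof -
      have "norm (z j - (xbar, ybar)) \<le> norm (z j - (x, y)) + norm ((x, y) - (xbar, ybar))"
        unfolding dist_norm[symmetric] by (rule dist_triangle)
      also have "\<dots> \<le> \<epsilon> k + \<epsilon> k"
        using j(1) *(2) by (intro add_mono) (simp_all add: dist_norm)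
      finally show ?thesis by simp
    qed
    ultimately show ?thesis
      using *(1) z(1)[of j] orth_proj_in[OF M, of e] e(2) small by (meson less_imp_le)
  qed
  then obtain u s p e where u: "\<And>k. norm (u k - xbar) \<le> \<epsilon> k" and s: "\<And>k. s k \<in> smooth_pts F"
    and s_lim: "\<And>k. norm (s k - (xbar, ybar)) \<le> 2 * \<epsilon> k"
    and p: "\<And>k. p k \<in> dual_subspace (tangent_cone (gph F) (s k))"
    and e: "\<And>k. norm (e k) = 1" "\<And>k. norm (p k - e k) \<le> \<epsilon> k"
      "\<And>k. norm (fst (e k) v* A (u k) + snd (e k)) \<le> \<epsilon> k"
    by metis
  define z where "z k = (fst (s k), snd (s k) + g (fst (s k)))" for k
  have z: "z k \<in> smooth_pts G" for k
    unfolding z_def by (rule smooth_pts_gph_add(1)[OF FG deriv]) (use s in auto)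
  define M where "M k = dual_subspace (tangent_cone (gph G) (z k))" for k
  have M: "M k \<in> Zn" for k
    using z[of k] dual_subspace_in_Zn by (auto simp: M_def smooth_pts_def)
  define m where "m k = (fst (p k), snd (p k) + fst (p k) v* A (fst (s k)))" for k
  have m: "m k \<in> M k" for k
    unfolding m_def M_def z_def by (rule smooth_pts_gph_add(2)[OF FG deriv]) (use s p in auto)
  obtain w r1 where r1: "strict_mono r1" "(e \<circ> r1) \<longlonglongrightarrow> w"
    using bounded_imp_convergent_subsequence[of e] e(1) by (auto simp: bounded_iff)
  obtain S r2 where r2: "strict_mono r2" "subspace S" "dim S = DIM(real^'n)"
    "(\<lambda>k. dist_Z S (M (r1 (r2 k)))) \<longlonglongrightarrow> 0"
    by (rule Grassmannian_convergent_subsequence[of "\<lambda>k. M (r1 k)" "DIM(real^'n)"])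
      (use M in \<open>auto simp: Zn_def\<close>)
  define r where "r = r1 \<circ> r2"
  have r: "strict_mono r" unfolding r_def using r1(1) r2(1) by (rule strict_mono_o)
  have sub: "(\<lambda>k. f (r k)) \<longlonglongrightarrow> l" if "f \<longlonglongrightarrow> l" for f :: "nat \<Rightarrow> 'c::topological_space" and l
    using LIMSEQ_subseq_LIMSEQ[OF that r] by (simp add: o_def)
  have e_lim: "(\<lambda>k. e (r k)) \<longlonglongrightarrow> w"
    using LIMSEQ_subseq_LIMSEQ[OF r1(2) r2(1)] by (simp add: o_def r_def)
  have p_lim: "(\<lambda>k. p (r k)) \<longlonglongrightarrow> w"
    using tendsto_add[OF sub[OF \<epsilon>0[OF e(2)]] e_lim] by simp
  have u': "u \<longlonglongrightarrow> xbar" using \<epsilon>0[OF u] by (rule LIM_zero_cancel)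
  have s': "s \<longlonglongrightarrow> (xbar, ybar)"
  proof -
    have "(\<lambda>k. (1/2) *\<^sub>R (s k - (xbar, ybar))) \<longlonglongrightarrow> 0"
      by (rule \<epsilon>0) (use s_lim in \<open>simp add: mult.commute\<close>)
    from tendsto_scaleR[OF tendsto_const[of 2] this] show ?thesis
      by (simp add: LIM_zero_iff)
  qed
  have fst_s: "(\<lambda>k. fst (s k)) \<longlonglongrightarrow> xbar" and snd_s: "(\<lambda>k. snd (s k)) \<longlonglongrightarrow> ybar"
    using tendsto_fst[OF s'] tendsto_snd[OF s'] by simp_all
  have gcont: "isCont g xbar" using has_derivative_continuous[OF deriv] .
  have z': "z \<longlonglongrightarrow> (xbar, ybar + g xbar)"
    unfolding z_def by (intro tendsto_intros fst_s snd_s isCont_tendsto_compose[OF gcont fst_s])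
  have S: "S \<in> SCD_coderiv G xbar (ybar + g xbar)"
    unfolding SCD_coderiv_def
    using r2 z sub[OF z'] by (auto simp: Zn_def M_def r_def intro!: exI[of _ "\<lambda>k. z (r k)"])
  have "(\<lambda>k. fst (e (r k)) v* A (u (r k)) + snd (e (r k))) \<longlonglongrightarrow> fst w v* A xbar + snd w"
    using e_lim isCont_tendsto_compose[OF cont sub[OF u']]
    by (intro tendsto_intros tendsto_vector_matrix_mult)
  moreover have "(\<lambda>k. fst (e (r k)) v* A (u (r k)) + snd (e (r k))) \<longlonglongrightarrow> 0"
    using sub[OF \<epsilon>0[OF e(3)]] .
  ultimately have w0: "fst w v* A xbar + snd w = 0" by (rule LIMSEQ_unique)
  have "(\<lambda>k. m (r k)) \<longlonglongrightarrow> (fst w, snd w + fst w v* A xbar)"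
    unfolding m_def using p_lim isCont_tendsto_compose[OF cont sub[OF fst_s]]
    by (intro tendsto_intros tendsto_vector_matrix_mult) auto
  then have "(fst w, snd w + fst w v* A xbar) \<in> S"
    by (rule limit_in_limit_subspace[OF r2(2), rotated 3, where L = "\<lambda>k. M (r k)"])
      (use M m r2(4) in \<open>auto simp: Zn_def r_def\<close>)
  then have "(fst w, 0) \<in> S" using w0 by (simp add: add.commute)
  then have "fst w = 0" using reg[OF S] by blast
  with w0 have "w = 0" by (simp add: prod_eq_iff)
  moreover have "norm w = 1"
    using LIMSEQ_unique[OF tendsto_norm[OF e_lim]] e(1) by simp
  ultimately show False by simp
qed

section \<open>One Newton step\<close>

lemma norm_matrix_vector_mult_le:
  fixes A :: "real^'n^'m"
  shows "norm (A *v v) \<le> norm A * norm v"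
proof -
  have "norm (A *v v) = L2_set (\<lambda>i. \<bar>A $ i \<bullet> v\<bar>) UNIV"
    by (simp add: norm_vec_def matrix_mult_dot)
  also have "\<dots> \<le> L2_set (\<lambda>i. norm (A $ i) * norm v) UNIV"
    by (rule L2_set_mono) (simp_all add: Cauchy_Schwarz_ineq2)
  also have "\<dots> = norm A * norm v"
    by (simp add: norm_vec_def[of A] L2_set_left_distrib)
  finally show ?thesis .
qed

lemma eventually_calm:
  fixes f :: "'a::real_normed_vector \<Rightarrow> 'b::real_normed_vector"
  assumes "(f has_derivative D) (at xbar)"
  obtains K where "0 \<le> K" and "\<forall>\<^sub>F x in nhds xbar. norm (f x - f xbar) \<le> K * norm (x - xbar)"
proof -
  have D: "bounded_linear D" using assms by (rule has_derivative_bounded_linear)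
  obtain d where d: "0 < d"
    "\<And>x. norm (x - xbar) < d \<Longrightarrow> norm (f x - f xbar - D (x - xbar)) \<le> 1 * norm (x - xbar)"
    using assms unfolding has_derivative_at_alt by (meson zero_less_one)
  have "norm (f x - f xbar) \<le> (1 + onorm D) * norm (x - xbar)" if "dist x xbar < d" for x
  proof -
    have "norm (f x - f xbar) \<le> norm (f x - f xbar - D (x - xbar)) + norm (D (x - xbar))"
      using norm_triangle_ineq[of "f x - f xbar - D (x - xbar)" "D (x - xbar)"] by simp
    also have "\<dots> \<le> 1 * norm (x - xbar) + onorm D * norm (x - xbar)"
      using that by (intro add_mono d onorm[OF D]) (simp add: dist_norm)
    finally show ?thesis by (simp add: algebra_simps)
  qed
  moreover have "0 \<le> 1 + onorm D" using onorm_pos_le[OF D] by simp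
  ultimately show ?thesis using that d(1) by (auto simp: eventually_nhds_metric)
qed

text \<open>
  The derivative is taken at the moving point \<open>x\<close>, not at \<open>xbar\<close>; the two differ by little because \<open>A\<close>
  is continuous at \<open>xbar\<close>.
\<close>

lemma eventually_linearisation_at_base_point:
  fixes f :: "real^'n \<Rightarrow> real^'m"
  assumes "(f has_derivative ((*v) (A xbar))) (at xbar)" and "isCont A xbar" and "0 < \<eta>"
  shows "\<forall>\<^sub>F x in nhds xbar. norm (f xbar - f x + A x *v (x - xbar)) \<le> \<eta> * norm (x - xbar)"
proof -
  have "0 < \<eta> / 2" using assms(3) by simp
  then obtain d where d: "0 < d"
    "\<And>x. norm (x - xbar) < d \<Longrightarrow> norm (f x - f xbar - A xbar *v (x - xbar)) \<le> \<eta> / 2 * norm (x - xbar)"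
    using assms(1) unfolding has_derivative_at_alt by blast
  have "\<forall>\<^sub>F x in nhds xbar. dist x xbar < d" using d(1) by (auto simp: eventually_nhds_metric)
  moreover have "\<forall>\<^sub>F x in nhds xbar. dist (A x) (A xbar) < \<eta> / 2"
    using assms(2) \<open>0 < \<eta> / 2\<close> unfolding isCont_def tendsto_at_iff_tendsto_nhds by (rule tendstoD)
  ultimately show ?thesis
  proof eventually_elim
    case (elim x)
    have "f xbar - f x + A x *v (x - xbar)
        = (A x - A xbar) *v (x - xbar) - (f x - f xbar - A xbar *v (x - xbar))"
      by (simp add: matrix_vector_mult_diff_rdistrib)
    then have "norm (f xbar - f x + A x *v (x - xbar))
        \<le> norm ((A x - A xbar) *v (x - xbar)) + norm (f x - f xbar - A xbar *v (x - xbar))"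
      by (simp only: norm_triangle_ineq4)
    also have "\<dots> \<le> \<eta> / 2 * norm (x - xbar) + \<eta> / 2 * norm (x - xbar)"
    proof (rule add_mono)
      have "norm ((A x - A xbar) *v (x - xbar)) \<le> norm (A x - A xbar) * norm (x - xbar)"
        by (rule norm_matrix_vector_mult_le)
      also have "\<dots> \<le> \<eta> / 2 * norm (x - xbar)"
        using elim(2) by (intro mult_right_mono) (simp_all add: dist_norm)
      finally show "norm ((A x - A xbar) *v (x - xbar)) \<le> \<eta> / 2 * norm (x - xbar)" .
    qed (use elim(1) d(2) in \<open>simp add: dist_norm\<close>)
    finally show ?case by simp
  qed
qed

text \<open>
  With \<open>w\<close> the primal displacement, the dual displacement is \<open>s - \<gamma> w\<close>, where
  \<open>s = \<gamma> (x - xbar) - (f x - f xbar)\<close>. Monotonicity, \<open>0 \<le> (s - \<gamma> w) \<bullet> w\<close>, bounds \<open>\<gamma> * norm w\<close>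
  by \<open>norm s\<close>.
\<close>

lemma prox_step_estimate:
  fixes f :: "real^'n \<Rightarrow> real^'n"
  assumes "proper_fun q" and "convex_fun q" and "lsc_fun q" and sol: "- f xbar \<in> subdifferential q xbar"
    and \<gamma>: "0 < \<gamma>l" "\<gamma> \<in> {\<gamma>l..\<gamma>u}" and calm: "norm (f x - f xbar) \<le> K * norm (x - xbar)" and "0 \<le> K"
  shows "norm ((d_hat f q \<gamma> x, d_hat_star f q \<gamma> x) - (xbar, - f xbar))
    \<le> (\<gamma>u + K) * (1 / \<gamma>l + 2) * norm (x - xbar)"
proof -
  define e where "e = x - xbar"
  define w where "w = d_hat f q \<gamma> x - xbar"
  define s where "s = \<gamma> *\<^sub>R e - (f x - f xbar)"
  have "0 < \<gamma>" using \<gamma> by simp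
  have star: "d_hat_star f q \<gamma> x - - f xbar = s - \<gamma> *\<^sub>R w"
    by (simp add: d_hat_star_def d_hat_def s_def w_def e_def algebra_simps)
  have s: "norm s \<le> (\<gamma>u + K) * norm e"
  proof -
    have "norm s \<le> \<gamma> * norm e + norm (f x - f xbar)"
      using norm_triangle_ineq4[of "\<gamma> *\<^sub>R e" "f x - f xbar"] \<open>0 < \<gamma>\<close> by (simp add: s_def)
    also have "\<dots> \<le> \<gamma>u * norm e + K * norm e"
      using calm \<gamma> by (intro add_mono mult_right_mono) (simp_all add: e_def)
    finally show ?thesis by (simp add: algebra_simps)
  qed
  have "d_hat_star f q \<gamma> x \<in> subdifferential q (d_hat f q \<gamma> x)"
    by (rule u_gamma_subgradient[OF assms(1-3) _ \<open>0 < \<gamma>\<close>]) (use sol in auto)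
  from subdifferential_monotone[OF this sol] have "0 \<le> (s - \<gamma> *\<^sub>R w) \<bullet> w"
    unfolding star w_def .
  then have "\<gamma> * (norm w * norm w) \<le> s \<bullet> w"
    by (simp add: inner_diff_left power2_norm_eq_inner[symmetric] power2_eq_square)
  also have "\<dots> \<le> norm s * norm w" by (rule norm_cauchy_schwarz)
  finally have w: "\<gamma> * norm w \<le> norm s"
    by (cases "w = 0") (auto simp: mult.assoc[symmetric])
  have "\<gamma>l * norm w \<le> \<gamma> * norm w" using \<gamma> by (intro mult_right_mono) auto
  with w have "norm w \<le> norm s / \<gamma>l" using \<gamma>(1) by (simp add: field_simps)
  moreover have "norm (s - \<gamma> *\<^sub>R w) \<le> 2 * norm s"
    using norm_triangle_ineq4[of s "\<gamma> *\<^sub>R w"] w \<open>0 < \<gamma>\<close> by simp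
  ultimately have "norm (w, s - \<gamma> *\<^sub>R w) \<le> norm s / \<gamma>l + 2 * norm s"
    using norm_Pair_le[of w "s - \<gamma> *\<^sub>R w"] by linarith
  also have "\<dots> = norm s * (1 / \<gamma>l + 2)" by (simp add: algebra_simps)
  also have "\<dots> \<le> (\<gamma>u + K) * norm e * (1 / \<gamma>l + 2)" using s \<gamma>(1) by (intro mult_right_mono) auto
  finally have "norm (w, s - \<gamma> *\<^sub>R w) \<le> (\<gamma>u + K) * (1 / \<gamma>l + 2) * norm e"
    by (simp only: mult.assoc mult.commute[of "norm e"])
  moreover have "(d_hat f q \<gamma> x, d_hat_star f q \<gamma> x) - (xbar, - f xbar) = (w, s - \<gamma> *\<^sub>R w)"
    by (simp only: diff_Pair star w_def)
  ultimately show ?thesis by (simp only: e_def)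
qed

lemma inner_newton_matrix:
  fixes X Y J :: "real^'n^'n"
  shows "p \<bullet> ((transpose Y ** J + transpose X) *v v) = (Y *v p) \<bullet> (J *v v) + (X *v p) \<bullet> v"
proof -
  have T: "p \<bullet> (transpose A *v v) = (A *v p) \<bullet> v" for A :: "real^'n^'n" and v
    by (metis dot_lmul_matrix vector_transpose_matrix)
  show ?thesis
    unfolding matrix_vector_mult_add_rdistrib matrix_vector_mul_assoc[symmetric] inner_add_right T ..
qed

lemma transpose_newton_matrix:
  fixes X Y J :: "real^'n^'n"
  shows "transpose (transpose Y ** J + transpose X) *v p = (Y *v p) v* J + X *v p"
proof -
  have "(transpose (transpose Y ** J + transpose X) *v p) \<bullet> v = ((Y *v p) v* J + X *v p) \<bullet> v" for v
    using inner_newton_matrix[of p Y J X v] by (simp add: dot_lmul_matrix inner_add_left)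
  then show ?thesis by (metis vector_eq_rdot)
qed

text \<open>
  The hypothesis on \<open>\<kappa>\<close> bounds \<open>(Y p, X p)\<close> by the transpose of \<open>M\<close> applied to \<open>p\<close>; so that transpose is
  injective. For the residual bound one takes \<open>p\<close> with \<open>M\<^sup>T p = e\<close>, whence
  \<open>norm e ^ 2 = p \<bullet> M e\<close>.
\<close>

lemma
  fixes X Y J :: "real^'n^'n"
  defines "M \<equiv> transpose Y ** J + transpose X"
  assumes rge: "rge Y X \<in> Zn"
    and bound: "\<And>ys xs. (ys, xs) \<in> rge Y X \<Longrightarrow> norm (ys, xs) \<le> \<kappa> * norm (ys v* J + xs)"
  shows newton_matrix_invertible: "invertible M"
    and newton_matrix_residual_bound:
      "\<lbrakk>\<And>p. \<bar>p \<bullet> (M *v e)\<bar> \<le> c * norm (Y *v p, X *v p); 0 \<le> c; 0 \<le> \<kappa>\<rbrakk> \<Longrightarrow> norm e \<le> \<kappa> * c"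
proof -
  have b: "norm (Y *v p, X *v p) \<le> \<kappa> * norm (transpose M *v p)" for p
    unfolding M_def transpose_newton_matrix by (rule bound) (simp add: rge_def)
  have "p = 0" if "transpose M *v p = 0" for p
    using b[of p] that rge_in_Zn_inj[OF rge, of p] by (simp add: norm_le_zero_iff zero_prod_def)
  then have "inj ((*v) (transpose M))"
    by (subst linear_injective_0) auto
  then have "invertible (transpose M)"
    by (simp add: invertible_left_inverse matrix_left_invertible_injective)
  then show inv: "invertible M" using transpose_invertible[of "transpose M"] by simp
  assume res: "\<And>p. \<bar>p \<bullet> (M *v e)\<bar> \<le> c * norm (Y *v p, X *v p)" and "0 \<le> c" and "0 \<le> \<kappa>"
  obtain B where "transpose M ** B = mat 1"
    using \<open>invertible (transpose M)\<close> by (auto simp: invertible_def)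
  then have p: "transpose M *v (B *v e) = e"
    by (simp only: matrix_vector_mul_assoc matrix_vector_mul_lid)
  have "norm e * norm e = (transpose M *v (B *v e)) \<bullet> e"
    unfolding p by (simp add: power2_norm_eq_inner[symmetric] power2_eq_square)
  also have "\<dots> = (B *v e) \<bullet> (M *v e)" by (simp add: dot_lmul_matrix)
  also have "\<dots> \<le> c * norm (Y *v (B *v e), X *v (B *v e))" using res[of "B *v e"] by linarith
  also have "\<dots> \<le> c * (\<kappa> * norm e)"
    using b[of "B *v e"] \<open>0 \<le> c\<close> unfolding p by (intro mult_left_mono)
  finally show "norm e \<le> \<kappa> * c"
    by (cases "e = 0") (use \<open>0 \<le> c\<close> \<open>0 \<le> \<kappa>\<close> in \<open>auto simp: mult.assoc[symmetric] mult.commute[of c]\<close>)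
qed

lemma ex1_matrix_equation:
  fixes M :: "real^'n^'n"
  assumes "invertible M"
  shows "\<exists>!v. M *v v = r"
proof -
  obtain B where B: "M ** B = mat 1" "B ** M = mat 1" using assms by (auto simp: invertible_def)
  show ?thesis
  proof
    show "M *v (B *v r) = r" by (simp only: matrix_vector_mul_assoc B matrix_vector_mul_lid)
    show "v = B *v r" if "M *v v = r" for v
      unfolding that[symmetric] by (simp only: matrix_vector_mul_assoc B matrix_vector_mul_lid)
  qed
qed

text \<open>
  In the Newton equation \<open>\<gamma> u = - d* - f x\<close> is substituted, so that all displacements are measured
  from the solution \<open>(xbar, - f xbar)\<close>.
\<close>

lemma newton_error_identity:
  assumes "newton_equation f q \<gamma> x X Y \<Delta>"
  shows "p \<bullet> ((transpose Y ** jacobian f (at x) + transpose X) *v (x + \<Delta> - xbar))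
    = (X *v p) \<bullet> (d_hat f q \<gamma> x - xbar) - (Y *v p) \<bullet> (d_hat_star f q \<gamma> x - - f xbar)
      + (Y *v p) \<bullet> (f xbar - f x + jacobian f (at x) *v (x - xbar))"
proof -
  let ?M = "transpose Y ** jacobian f (at x) + transpose X"
  let ?u = "u_gamma f q \<gamma> x"
  \<comment> \<open>The right-hand side of the Newton equation is itself a Newton matrix, with \<open>\<gamma> I\<close> in place of the
    Jacobian.\<close>
  have "\<gamma> *\<^sub>R transpose Y + transpose X = transpose Y ** (\<gamma> *\<^sub>R mat 1) + transpose X"
    by (simp add: matrix_scalar_ac scalar_matrix_assoc)
  then have "p \<bullet> (?M *v \<Delta>) = (Y *v p) \<bullet> (\<gamma> *\<^sub>R ?u) + (X *v p) \<bullet> ?u"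
    using assms inner_newton_matrix[of p Y "\<gamma> *\<^sub>R mat 1" X ?u]
    by (simp add: newton_equation_def scaleR_matrix_vector_assoc[symmetric])
  moreover have "p \<bullet> (?M *v (x + \<Delta> - xbar)) = p \<bullet> (?M *v \<Delta>) + p \<bullet> (?M *v (x - xbar))"
  proof -
    have "x + \<Delta> - xbar = \<Delta> + (x - xbar)" by simp
    then show ?thesis by (simp only: matrix_vector_right_distrib inner_add_right)
  qed
  ultimately show ?thesis
    by (simp add: inner_newton_matrix d_hat_def d_hat_star_def inner_diff_right inner_add_right)
qed

section \<open>Local contraction and superlinear convergence\<close>

text \<open>
  With semismoothness* tolerance \<open>\<epsilon>\<close> and
  linearisation tolerance \<open>\<eta>\<close> the new error is at most \<open>\<kappa> * (\<epsilon> * C + \<eta>)\<close> times the old one. That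
  the Newton step is available at all follows from the SCD property of \<open>\<partial>q\<close> near
  \<open>(xbar, - f xbar)\<close>, which provides the matrices \<open>X\<close>, \<open>Y\<close>, and from the invertibility of the Newton
  matrix.
\<close>

lemma newton_contraction:
  fixes f :: "real^'n \<Rightarrow> real^'n" and q :: "real^'n \<Rightarrow> ereal"
  assumes diff: "\<forall>x. f differentiable (at x)" and cont: "continuous_on UNIV (\<lambda>x. jacobian f (at x))"
    and q: "proper_fun q" "convex_fun q" "lsc_fun q"
    and sol: "0 \<in> gen_map f q xbar"
    and semi: "SCD_semismooth_star (subdifferential q) xbar (- f xbar)"
    and reg: "SCD_regular (gen_map f q) xbar 0"
    and \<gamma>: "0 < \<gamma>l" "\<gamma>l \<le> \<gamma>u" and \<theta>: "0 < \<theta>"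
  shows "\<forall>\<^sub>F x in nhds xbar. newton_step_possible f q \<gamma>l \<gamma>u x \<and>
    (\<forall>\<gamma>\<in>{\<gamma>l..\<gamma>u}. \<forall>X Y x'. newton_step f q \<gamma> x X Y x' \<longrightarrow> norm (x' - xbar) \<le> \<theta> * norm (x - xbar))"
proof -
  let ?J = "\<lambda>x. jacobian f (at x)"
  have deriv: "(f has_derivative ((*v) (?J x))) (at x)" for x
    using diff jacobian_works by blast
  have contJ: "isCont ?J xbar" using cont by (simp add: continuous_on_eq_continuous_at)
  have sol': "- f xbar \<in> subdifferential q xbar"
    using sol by (auto simp: gen_map_def add_eq_0_iff)
  obtain K where K: "0 \<le> K" "\<forall>\<^sub>F x in nhds xbar. norm (f x - f xbar) \<le> K * norm (x - xbar)"
    using eventually_calm[OF deriv] by blast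
  have FG: "v \<in> subdifferential q x \<longleftrightarrow> v + f x \<in> gen_map f q x" for x v
    by (auto simp: gen_map_def add.commute)
  obtain \<kappa> \<rho> where \<kappa>: "0 < \<kappa>" "0 < \<rho>"
    "\<And>u x y L ys xs. \<lbrakk>norm (u - xbar) < \<rho>; norm ((x, y) - (xbar, - f xbar)) < \<rho>;
        L \<in> SCD_coderiv (subdifferential q) x y; (ys, xs) \<in> L\<rbrakk>
      \<Longrightarrow> norm (ys, xs) \<le> \<kappa> * norm (ys v* ?J u + xs)"
  proof (rule SCD_regular_uniform_bound[OF FG deriv contJ, where ybar = "- f xbar"])
    show "ys = 0" if "L \<in> SCD_coderiv (gen_map f q) xbar (- f xbar + f xbar)" "(ys, 0) \<in> L" for L ys
      using reg that by (simp add: SCD_regular_def)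
  qed blast
  define C where "C = (\<gamma>u + K) * (1 / \<gamma>l + 2)"
  have C: "0 < C" using \<gamma> K(1) unfolding C_def by (intro mult_pos_pos add_pos_nonneg add_nonneg_pos) auto
  \<comment> \<open>Each of the two error sources gets half of \<open>\<theta>\<close>.\<close>
  define \<epsilon> where "\<epsilon> = \<theta> / (2 * \<kappa> * C)"
  define \<eta> where "\<eta> = \<theta> / (2 * \<kappa>)"
  have pos: "0 < \<epsilon>" "0 < \<eta>" using C \<kappa>(1) \<theta> by (simp_all add: \<epsilon>_def \<eta>_def)
  have \<theta>_eq: "\<kappa> * (\<epsilon> * C + \<eta>) = \<theta>" using C \<kappa>(1) by (simp add: \<epsilon>_def \<eta>_def field_simps)
  obtain \<delta> where \<delta>: "0 < \<delta>"
    "\<And>x y L ys xs. \<lbrakk>y \<in> subdifferential q x; norm ((x, y) - (xbar, - f xbar)) \<le> \<delta>;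
        L \<in> SCD_coderiv (subdifferential q) x y; (ys, xs) \<in> L\<rbrakk>
      \<Longrightarrow> \<bar>xs \<bullet> (x - xbar) - ys \<bullet> (y - - f xbar)\<bar> \<le> \<epsilon> * norm ((x, y) - (xbar, - f xbar)) * norm (ys, xs)"
  proof -
    from semi pos(1) obtain \<delta> where "0 < \<delta>" and d: "\<forall>(x, y) \<in> gph (subdifferential q).
        norm ((x, y) - (xbar, - f xbar)) \<le> \<delta> \<longrightarrow>
        (\<forall>L \<in> SCD_coderiv (subdifferential q) x y. \<forall>(ys, xs) \<in> L. \<bar>xs \<bullet> (x - xbar) - ys \<bullet> (y - - f xbar)\<bar>
          \<le> \<epsilon> * norm ((x, y) - (xbar, - f xbar)) * norm (xs, ys))"
      unfolding SCD_semismooth_star_def by blast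
    have swap: "norm (a, b) = norm (b, a)" for a b :: "real^'n"
      by (simp add: norm_Pair add.commute)
    show ?thesis
    proof (rule that[OF \<open>0 < \<delta>\<close>])
      fix x y L ys xs
      assume *: "y \<in> subdifferential q x" "norm ((x, y) - (xbar, - f xbar)) \<le> \<delta>"
        "L \<in> SCD_coderiv (subdifferential q) x y" "(ys, xs) \<in> L"
      have "(x, y) \<in> gph (subdifferential q)" using *(1) by (simp add: gph_def)
      from d[rule_format, OF this, unfolded prod.case, rule_format, OF *(2,3,4)]
      show "\<bar>xs \<bullet> (x - xbar) - ys \<bullet> (y - - f xbar)\<bar>
          \<le> \<epsilon> * norm ((x, y) - (xbar, - f xbar)) * norm (ys, xs)"
        unfolding prod.case swap[of xs ys] .
    qed
  qed
  obtain \<omega> where \<omega>: "0 < \<omega>" "\<And>x y. \<lbrakk>y \<in> subdifferential q x; norm ((x, y) - (xbar, - f xbar)) < \<omega>\<rbrakk>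
      \<Longrightarrow> SCD_coderiv (subdifferential q) x y \<noteq> {}"
  proof -
    from semi obtain W where W: "open W" "(xbar, - f xbar) \<in> W"
      "\<forall>(x, y) \<in> gph (subdifferential q) \<inter> W. SCD_coderiv (subdifferential q) x y \<noteq> {}"
      unfolding SCD_semismooth_star_def SCD_property_def by blast
    from W(1,2) obtain \<omega> where "0 < \<omega>" "ball (xbar, - f xbar) \<omega> \<subseteq> W" using openE by blast
    show ?thesis
    proof (rule that[OF \<open>0 < \<omega>\<close>])
      fix x y
      assume y: "y \<in> subdifferential q x" and "norm ((x, y) - (xbar, - f xbar)) < \<omega>"
      then have "(x, y) \<in> W"
        using \<open>ball (xbar, - f xbar) \<omega> \<subseteq> W\<close>
        by (metis dist_commute dist_norm mem_ball subsetD)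
      then show "SCD_coderiv (subdifferential q) x y \<noteq> {}"
        using W(3) y by (auto simp: gph_def)
    qed
  qed
  have near: "\<forall>\<^sub>F x in nhds xbar. C * norm (x - xbar) < r" if "0 < r" for r
  proof -
    have "\<forall>\<^sub>F x in nhds xbar. dist x xbar < r / C"
      unfolding eventually_nhds_metric using that C by (intro exI[of _ "r / C"]) simp
    then show ?thesis
      by eventually_elim (use C in \<open>simp add: dist_norm field_simps\<close>)
  qed
  have nearx: "\<forall>\<^sub>F x in nhds xbar. dist x xbar < \<rho>"
    using \<kappa>(2) by (auto simp: eventually_nhds_metric)
  show ?thesis
    using K(2) near[OF \<kappa>(2)] near[OF \<delta>(1)] near[OF \<omega>(1)] nearx
      eventually_linearisation_at_base_point[OF deriv contJ pos(2)]
  proof eventually_elim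
    case (elim x)
    have main: "(\<exists>X Y. admissible_matrices f q \<gamma> x X Y) \<and>
      (\<forall>X Y. admissible_matrices f q \<gamma> x X Y \<longrightarrow> (\<exists>!\<Delta>. newton_equation f q \<gamma> x X Y \<Delta>) \<and>
        (\<forall>\<Delta>. newton_equation f q \<gamma> x X Y \<Delta> \<longrightarrow> norm (x + \<Delta> - xbar) \<le> \<theta> * norm (x - xbar)))"
      if g: "\<gamma> \<in> {\<gamma>l..\<gamma>u}" for \<gamma>
    proof (intro conjI allI impI)
      let ?d = "d_hat f q \<gamma> x" and ?ds = "d_hat_star f q \<gamma> x"
      have dist: "norm ((?d, ?ds) - (xbar, - f xbar)) \<le> C * norm (x - xbar)"
        unfolding C_def by (rule prox_step_estimate[OF q sol' \<gamma>(1) g elim(1) K(1)])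
      have mem: "?ds \<in> subdifferential q ?d"
        by (rule u_gamma_subgradient[OF q, of xbar]) (use sol' \<gamma> g in auto)
      have "SCD_coderiv (subdifferential q) ?d ?ds \<noteq> {}"
        by (rule \<omega>(2)[OF mem]) (use dist elim(4) in linarith)
      then obtain L where L: "L \<in> SCD_coderiv (subdifferential q) ?d ?ds" by blast
      then have "L \<in> Zn" by (simp add: SCD_coderiv_def)
      then obtain X Y where "rge Y X = L" by (rule Zn_eq_rge)
      with L show "\<exists>X Y. admissible_matrices f q \<gamma> x X Y"
        unfolding admissible_matrices_def by blast
      fix X Y assume adm: "admissible_matrices f q \<gamma> x X Y"
      let ?M = "transpose Y ** ?J x + transpose X"
      have R: "rge Y X \<in> SCD_coderiv (subdifferential q) ?d ?ds"
        using adm by (simp add: admissible_matrices_def)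
      then have Z: "rge Y X \<in> Zn" by (simp add: SCD_coderiv_def)
      have bound: "norm (ys, xs) \<le> \<kappa> * norm (ys v* ?J x + xs)" if "(ys, xs) \<in> rge Y X" for ys xs
        by (rule \<kappa>(3)[OF _ _ R that]) (use dist elim(2,5) in \<open>auto simp: dist_norm\<close>)
      show "\<exists>!\<Delta>. newton_equation f q \<gamma> x X Y \<Delta>"
        unfolding newton_equation_def
        by (rule ex1_matrix_equation) (rule newton_matrix_invertible[OF Z bound])
      fix \<Delta> assume eq: "newton_equation f q \<gamma> x X Y \<Delta>"
      let ?c = "(\<epsilon> * C + \<eta>) * norm (x - xbar)"
      have res: "\<bar>p \<bullet> (?M *v (x + \<Delta> - xbar))\<bar> \<le> ?c * norm (Y *v p, X *v p)" for p
      proof -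
        let ?r = "f xbar - f x + ?J x *v (x - xbar)"
        have "\<bar>(X *v p) \<bullet> (?d - xbar) - (Y *v p) \<bullet> (?ds - - f xbar)\<bar>
            \<le> \<epsilon> * norm ((?d, ?ds) - (xbar, - f xbar)) * norm (Y *v p, X *v p)"
          by (rule \<delta>(2)[OF mem _ R]) (use dist elim(3) in \<open>auto simp: rge_def\<close>)
        also have "\<dots> \<le> \<epsilon> * (C * norm (x - xbar)) * norm (Y *v p, X *v p)"
          using dist pos(1) by (intro mult_right_mono mult_left_mono) auto
        finally have 1: "\<bar>(X *v p) \<bullet> (?d - xbar) - (Y *v p) \<bullet> (?ds - - f xbar)\<bar>
            \<le> \<epsilon> * (C * norm (x - xbar)) * norm (Y *v p, X *v p)" .
        have "\<bar>(Y *v p) \<bullet> ?r\<bar> \<le> norm (Y *v p) * norm ?r" by (rule Cauchy_Schwarz_ineq2)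
        also have "\<dots> \<le> norm (Y *v p, X *v p) * (\<eta> * norm (x - xbar))"
          using elim(6) norm_fst_le[of "Y *v p" "X *v p"] by (intro mult_mono) auto
        finally show ?thesis
          using 1 unfolding newton_error_identity[OF eq] by (simp add: algebra_simps)
      qed
      have "norm (x + \<Delta> - xbar) \<le> \<kappa> * ?c"
      proof (rule newton_matrix_residual_bound[OF Z])
        show "0 \<le> ?c" "0 \<le> \<kappa>" using \<kappa>(1) C pos by simp_all
      qed (fact bound res)+
      then show "norm (x + \<Delta> - xbar) \<le> \<theta> * norm (x - xbar)"
        by (simp only: mult.assoc[symmetric] \<theta>_eq)
    qed
    then show ?case
      unfolding newton_step_possible_def newton_step_def by blast
  qed
qed

theorem theorem5p2:
  fixes f :: "real^'n \<Rightarrow> real^'n" and q :: "real^'n \<Rightarrow> ereal" and xbar :: "real^'n"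
  assumes "\<forall>x. f differentiable (at x)" and "continuous_on UNIV (\<lambda>x. jacobian f (at x))"
    and "proper_fun q" and "convex_fun q" and "lsc_fun q"
    and "0 \<in> gen_map f q xbar"
    and "SCD_semismooth_star (subdifferential q) xbar (- f xbar)"
    and "SCD_regular (gen_map f q) xbar 0"
  shows "\<forall>\<gamma>l \<gamma>u. 0 < \<gamma>l \<and> \<gamma>l \<le> \<gamma>u \<longrightarrow>
    (\<exists>U. open U \<and> xbar \<in> U \<and>
      (\<forall>x \<gamma> X Y. x 0 \<in> U \<longrightarrow>
        (\<forall>N. newton_run_upto f q \<gamma>l \<gamma>u \<gamma> X Y x N \<and> (\<forall>k\<le>N. 0 \<notin> gen_map f q (x k))
               \<longrightarrow> newton_step_possible f q \<gamma>l \<gamma>u (x N)) \<and>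
        ((\<forall>N. newton_run_upto f q \<gamma>l \<gamma>u \<gamma> X Y x N)
               \<longrightarrow> (\<exists>N. 0 \<in> gen_map f q (x N)) \<or> converges_superlinearly x xbar)))"
proof (intro allI impI, elim conjE)
  fix \<gamma>l \<gamma>u :: real
  assume \<gamma>: "0 < \<gamma>l" "\<gamma>l \<le> \<gamma>u"
  define contracts where "contracts \<theta> x \<longleftrightarrow> (\<forall>\<gamma>\<in>{\<gamma>l..\<gamma>u}. \<forall>X Y x'. newton_step f q \<gamma> x X Y x' \<longrightarrow>
      norm (x' - xbar) \<le> \<theta> * norm (x - xbar))" for \<theta> x
  have contractsD: "norm (x' - xbar) \<le> \<theta> * norm (x - xbar)"
    if "contracts \<theta> x" "\<gamma> \<in> {\<gamma>l..\<gamma>u}" "newton_step f q \<gamma> x X Y x'" for \<theta> \<gamma> x X Y x'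
    using that unfolding contracts_def by blast
  have contraction: "\<forall>\<^sub>F x in nhds xbar. newton_step_possible f q \<gamma>l \<gamma>u x \<and> contracts \<theta> x"
    if "0 < \<theta>" for \<theta>
    unfolding contracts_def by (rule newton_contraction[OF assms \<gamma> that])
  have "\<forall>\<^sub>F x in nhds xbar. newton_step_possible f q \<gamma>l \<gamma>u x \<and> contracts (1/2) x"
    by (rule contraction) simp
  then obtain \<rho> where \<rho>: "0 < \<rho>"
    "\<And>x. dist x xbar < \<rho> \<Longrightarrow> newton_step_possible f q \<gamma>l \<gamma>u x \<and> contracts (1/2) x"
    unfolding eventually_nhds_metric by blast
  show "\<exists>U. open U \<and> xbar \<in> U \<and>
      (\<forall>x \<gamma> X Y. x 0 \<in> U \<longrightarrow>
        (\<forall>N. newton_run_upto f q \<gamma>l \<gamma>u \<gamma> X Y x N \<and> (\<forall>k\<le>N. 0 \<notin> gen_map f q (x k))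
               \<longrightarrow> newton_step_possible f q \<gamma>l \<gamma>u (x N)) \<and>
        ((\<forall>N. newton_run_upto f q \<gamma>l \<gamma>u \<gamma> X Y x N)
               \<longrightarrow> (\<exists>N. 0 \<in> gen_map f q (x N)) \<or> converges_superlinearly x xbar))"
  proof (intro exI conjI allI impI)
    show "open (ball xbar \<rho>)" "xbar \<in> ball xbar \<rho>" using \<rho>(1) by simp_all
    fix x :: "nat \<Rightarrow> real^'n" and \<gamma> X Y
    assume x0: "x 0 \<in> ball xbar \<rho>"
    have step: "\<gamma> k \<in> {\<gamma>l..\<gamma>u}" "newton_step f q (\<gamma> k) (x k) (X k) (Y k) (x (Suc k))"
      if "newton_run_upto f q \<gamma>l \<gamma>u \<gamma> X Y x N" "\<forall>k\<le>N. 0 \<notin> gen_map f q (x k)" "k < N" for k N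
      using that by (auto simp: newton_run_upto_def)
    have decay: "norm (x k - xbar) \<le> (1/2) ^ k * norm (x 0 - xbar)"
      if run: "newton_run_upto f q \<gamma>l \<gamma>u \<gamma> X Y x N" "\<forall>k\<le>N. 0 \<notin> gen_map f q (x k)" and "k \<le> N" for k N
      using \<open>k \<le> N\<close>
    proof (induction k)
      case (Suc k)
      then have IH: "norm (x k - xbar) \<le> (1/2) ^ k * norm (x 0 - xbar)" by simp
      also have "\<dots> \<le> 1 * norm (x 0 - xbar)"
        by (intro mult_right_mono power_le_one) simp_all
      finally have "dist (x k) xbar < \<rho>" using x0 by (simp add: dist_norm norm_minus_commute)
      then have "contracts (1/2) (x k)" using \<rho>(2) by blast
      then have "norm (x (Suc k) - xbar) \<le> 1/2 * norm (x k - xbar)"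
        by (rule contractsD[OF _ step[OF run]]) (use Suc.prems in simp_all)
      with IH show ?case by simp
    qed simp
    have in_ball: "dist (x N) xbar < \<rho>"
      if "newton_run_upto f q \<gamma>l \<gamma>u \<gamma> X Y x N" "\<forall>k\<le>N. 0 \<notin> gen_map f q (x k)" for N
    proof -
      have "norm (x N - xbar) \<le> (1/2) ^ N * norm (x 0 - xbar)" using decay[OF that] by simp
      also have "\<dots> \<le> 1 * norm (x 0 - xbar)"
        by (intro mult_right_mono power_le_one) simp_all
      finally show ?thesis using x0 by (simp add: dist_norm norm_minus_commute)
    qed
    {
      fix N
      assume "newton_run_upto f q \<gamma>l \<gamma>u \<gamma> X Y x N \<and> (\<forall>k\<le>N. 0 \<notin> gen_map f q (x k))"
      then show "newton_step_possible f q \<gamma>l \<gamma>u (x N)" using in_ball \<rho>(2) by blast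
    }
    assume run: "\<forall>N. newton_run_upto f q \<gamma>l \<gamma>u \<gamma> X Y x N"
    show "(\<exists>N. 0 \<in> gen_map f q (x N)) \<or> converges_superlinearly x xbar"
    proof (rule disj_imp[THEN iffD2], rule impI)
      assume "\<nexists>N. 0 \<in> gen_map f q (x N)"
      then have no_stop: "\<forall>k\<le>N. 0 \<notin> gen_map f q (x k)" for N by blast
      have "(\<lambda>k. x k - xbar) \<longlonglongrightarrow> 0"
      proof (rule Lim_null_comparison)
        show "\<forall>\<^sub>F k in sequentially. norm (x k - xbar) \<le> (1/2) ^ k * norm (x 0 - xbar)"
          by (intro always_eventually allI decay[OF run[rule_format] no_stop order_refl])
        show "(\<lambda>k. (1/2) ^ k * norm (x 0 - xbar)) \<longlonglongrightarrow> 0"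
          by (intro tendsto_mult_left_zero LIMSEQ_power_zero) simp
      qed
      then have lim: "x \<longlonglongrightarrow> xbar" by (rule LIM_zero_cancel)
      have "(\<lambda>k. norm (x (Suc k) - xbar)) \<in> o(\<lambda>k. norm (x k - xbar))"
      proof (rule landau_o.smallI)
        fix c :: real assume "0 < c"
        have "\<forall>\<^sub>F k in sequentially. newton_step_possible f q \<gamma>l \<gamma>u (x k) \<and> contracts c (x k)"
          by (rule eventually_compose_filterlim[OF contraction[OF \<open>0 < c\<close>] lim])
        then show "\<forall>\<^sub>F k in sequentially. norm (norm (x (Suc k) - xbar)) \<le> c * norm (norm (x k - xbar))"
        proof eventually_elim
          case (elim k)
          from contractsD[OF conjunct2[OF elim] step[OF run[rule_format] no_stop lessI]]
          show ?case by simp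
        qed
      qed
      with lim show "converges_superlinearly x xbar" by (simp add: converges_superlinearly_def)
    qed
  qed
qed

end
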